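(* Let $\epsilon>0$ and $\Delta>0$. Let $\mathcal{SP}$ be the set of all Borel probability measures $\mathcal{P}$ on $\mathbb{R}^2$ such that $$\mathcal{P}(S)\le e^{\epsilon}\,\mathcal{P}(S+\mathbf{t})\quad\text{for all measurable } S\subseteq\mathbb{R}^2 \text{ and all } \mathbf{t}\in\mathbb{R}^2 \text{ with } \|\mathbf{t}\|_1\le\Delta .$$ For $\gamma\in[0,1]$ let $f_\gamma$ be the two-dimensional staircase-shaped probability density function on $\mathbb{R}^2$ with parameters $\epsilon,\Delta,\gamma$ (defined in the context). Then, for the cost function $\mathcal{L}(\mathbf{x})=\|\mathbf{x}\|_1$, $$\inf_{\mathcal{P}\in\mathcal{SP}}\int_{\mathbb{R}^2}\|\mathbf{x}\|_1\,\mathcal{P}(d\mathbf{x})=\inf_{\gamma\in[0,1]}\int_{\mathbb{R}^2}\|\mathbf{x}\|_1\, f_\gamma(\mathbf{x})\,d\mathbf{x}.$$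
   Context: Notation: $\mathbf{x}=(x_1,x_2)$, $\|\mathbf{x}\|_1=|x_1|+|x_2|$, $S+\mathbf{t}=\{\mathbf{s}+\mathbf{t}:\mathbf{s}\in S\}$, $\mathbb{N}=\{0,1,2,\dots\}$. For $\gamma\in[0,1]$ the staircase-shaped density is $$f_\gamma(\mathbf{x})=\begin{cases} e^{-k\epsilon}a(\gamma), & \|\mathbf{x}\|_1\in[k\Delta,(k+\gamma)\Delta),\ k\in\mathbb{N},\\ e^{-(k+1)\epsilon}a(\gamma), & \|\mathbf{x}\|_1\in[(k+\gamma)\Delta,(k+1)\Delta),\ k\in\mathbb{N},\end{cases}$$ where $a(\gamma)>0$ is the normalization constant making $\int_{\mathbb{R}^2}f_\gamma(\mathbf{x})\,d\mathbf{x}=1$. *)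

theory Defs
  imports "HOL-Probability.Probability"
begin

definition l1norm :: "real \<times> real \<Rightarrow> real" where
  "l1norm x = \<bar>fst x\<bar> + \<bar>snd x\<bar>"

definition SP :: "real \<Rightarrow> real \<Rightarrow> (real \<times> real) measure set" where
  "SP \<epsilon> \<Delta> = {P. prob_space P \<and> sets P = sets borel \<and>
     (\<forall>S \<in> sets borel. \<forall>t. l1norm t \<le> \<Delta> \<longrightarrow>
        measure P S \<le> exp \<epsilon> * measure P ((\<lambda>s. s + t) ` S))}"

text \<open>The staircase function with an arbitrary height \<open>a\<close>. The \<open>k\<close> below is the only natural
  number with \<open>k * \<Delta> \<le> l1norm x < (k + 1) * \<Delta>\<close>; the lemmas \<open>staircase_fun_left\<close>
  and \<open>staircase_fun_right\<close> give the two cases in terms of intervals.\<close>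

definition staircase_fun :: "real \<Rightarrow> real \<Rightarrow> real \<Rightarrow> real \<Rightarrow> real \<times> real \<Rightarrow> real" where
  "staircase_fun \<epsilon> \<Delta> \<gamma> a x =
     (let k = nat \<lfloor>l1norm x / \<Delta>\<rfloor> in
      if l1norm x < (real k + \<gamma>) * \<Delta> then exp (- real k * \<epsilon>) * a
      else exp (- (real k + 1) * \<epsilon>) * a)"

definition staircase_const :: "real \<Rightarrow> real \<Rightarrow> real \<Rightarrow> real" where
  "staircase_const \<epsilon> \<Delta> \<gamma> =
     (THE a. 0 < a \<and> (\<integral>\<^sup>+ x. ennreal (staircase_fun \<epsilon> \<Delta> \<gamma> a x) \<partial>lborel) = 1)"

definition staircase_density :: "real \<Rightarrow> real \<Rightarrow> real \<Rightarrow> real \<times> real \<Rightarrow> real" where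
  "staircase_density \<epsilon> \<Delta> \<gamma> = staircase_fun \<epsilon> \<Delta> \<gamma> (staircase_const \<epsilon> \<Delta> \<gamma>)"

lemma staircase_index:
  assumes "0 < \<Delta>" "l1norm x \<in> {real k * \<Delta>..<(real k + 1) * \<Delta>}"
  shows "nat \<lfloor>l1norm x / \<Delta>\<rfloor> = k"
proof -
  have "\<lfloor>l1norm x / \<Delta>\<rfloor> = int k"
    using assms by (intro floor_unique) (auto simp: field_simps)
  then show ?thesis by simp
qed

lemma staircase_fun_left:
  assumes "0 < \<Delta>" "\<gamma> \<in> {0..1}" "l1norm x \<in> {real k * \<Delta>..<(real k + \<gamma>) * \<Delta>}"
  shows "staircase_fun \<epsilon> \<Delta> \<gamma> a x = exp (- real k * \<epsilon>) * a"
proof -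
  have "(real k + \<gamma>) * \<Delta> \<le> (real k + 1) * \<Delta>"
    using assms by (intro mult_right_mono) auto
  with assms(3) have "l1norm x \<in> {real k * \<Delta>..<(real k + 1) * \<Delta>}"
    unfolding atLeastLessThan_iff by linarith
  then have "nat \<lfloor>l1norm x / \<Delta>\<rfloor> = k"
    using assms(1) by (intro staircase_index)
  then show ?thesis using assms by (simp add: staircase_fun_def Let_def)
qed

lemma staircase_fun_right:
  assumes "0 < \<Delta>" "\<gamma> \<in> {0..1}" "l1norm x \<in> {(real k + \<gamma>) * \<Delta>..<(real k + 1) * \<Delta>}"
  shows "staircase_fun \<epsilon> \<Delta> \<gamma> a x = exp (- (real k + 1) * \<epsilon>) * a"
proof -
  have "real k * \<Delta> \<le> (real k + \<gamma>) * \<Delta>"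
    using assms by (intro mult_right_mono) auto
  with assms(3) have "l1norm x \<in> {real k * \<Delta>..<(real k + 1) * \<Delta>}"
    unfolding atLeastLessThan_iff by linarith
  then have "nat \<lfloor>l1norm x / \<Delta>\<rfloor> = k"
    using assms(1) by (intro staircase_index)
  then show ?thesis using assms by (simp add: staircase_fun_def Let_def)
qed

lemma measurable_staircase_fun [measurable]:
  "staircase_fun \<epsilon> \<Delta> \<gamma> a \<in> borel_measurable borel"
  unfolding staircase_fun_def l1norm_def Let_def borel_prod[symmetric] by measurable

lemma nn_integral_exp_abs_finite:
  assumes "0 < (c::real)"
  shows "(\<integral>\<^sup>+ x. ennreal (exp (- c * \<bar>x\<bar>)) \<partial>lborel) < \<infinity>"
proof -
  let ?f = "\<lambda>x::real. ennreal (exp (- c * x)) * indicator {0..} x"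
  have lim: "((\<lambda>x. - exp (- c * x) / c) \<longlongrightarrow> 0) at_top"
    using assms by real_asymp
  have "integral\<^sup>N lborel ?f = ennreal (0 - (- exp (- c * 0) / c))"
    using assms lim
    by (intro nn_integral_FTC_atLeast) (auto intro!: derivative_eq_intros)
  then have half: "integral\<^sup>N lborel ?f < \<infinity>" by simp
  have refl: "integral\<^sup>N lborel ?f = (\<integral>\<^sup>+ x. ?f (- x) \<partial>lborel)"
    using nn_integral_real_affine[of ?f "-1" 0] by simp
  have "(\<integral>\<^sup>+ x. ennreal (exp (- c * \<bar>x\<bar>)) \<partial>lborel) \<le> (\<integral>\<^sup>+ x. ?f x + ?f (- x) \<partial>lborel)"
    by (intro nn_integral_mono) (auto simp: indicator_def abs_if)
  also have "\<dots> = integral\<^sup>N lborel ?f + (\<integral>\<^sup>+ x. ?f (- x) \<partial>lborel)"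
    by (intro nn_integral_add) measurable
  also have "\<dots> < \<infinity>" using half refl by simp
  finally show ?thesis .
qed

lemma staircase_fun_le:
  assumes "0 < \<epsilon>" "0 < \<Delta>"
  shows "staircase_fun \<epsilon> \<Delta> \<gamma> 1 x
    \<le> exp \<epsilon> * (exp (- (\<epsilon> / \<Delta>) * \<bar>fst x\<bar>) * exp (- (\<epsilon> / \<Delta>) * \<bar>snd x\<bar>))"
proof -
  define k where "k = nat \<lfloor>l1norm x / \<Delta>\<rfloor>"
  have "0 \<le> l1norm x / \<Delta>" using assms by (simp add: l1norm_def)
  then have "l1norm x / \<Delta> \<le> real k + 1" unfolding k_def by linarith
  then have "\<epsilon> * (l1norm x / \<Delta>) \<le> \<epsilon> * (real k + 1)"
    using assms by (intro mult_left_mono) auto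
  then have "- real k * \<epsilon> \<le> \<epsilon> + (- (\<epsilon> / \<Delta>) * \<bar>fst x\<bar> + - (\<epsilon> / \<Delta>) * \<bar>snd x\<bar>)"
    by (simp add: l1norm_def algebra_simps add_divide_distrib)
  moreover have "staircase_fun \<epsilon> \<Delta> \<gamma> 1 x \<le> exp (- real k * \<epsilon>)"
    using assms by (simp add: staircase_fun_def Let_def k_def algebra_simps)
  ultimately show ?thesis
    unfolding exp_add[symmetric] using exp_le_cancel_iff order_trans by blast
qed

text \<open>The definite description in \<^const>\<open>staircase_const\<close> is well defined.\<close>

lemma ex1_staircase_const:
  assumes "0 < \<epsilon>" "0 < \<Delta>"
  shows "\<exists>!a. 0 < a \<and> (\<integral>\<^sup>+ x. ennreal (staircase_fun \<epsilon> \<Delta> \<gamma> a x) \<partial>lborel) = 1"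
proof -
  let ?s = "staircase_fun \<epsilon> \<Delta> \<gamma>"
  define I where "I = (\<integral>\<^sup>+ x. ennreal (?s 1 x) \<partial>lborel)"
  have pos: "0 < ?s 1 x" for x by (simp add: staircase_fun_def Let_def)
  have scale: "(\<integral>\<^sup>+ x. ennreal (?s a x) \<partial>lborel) = ennreal a * I" if "0 < a" for a
  proof -
    have "?s a x = a * ?s 1 x" for x by (simp add: staircase_fun_def Let_def)
    then show ?thesis
      unfolding I_def using that pos
      by (subst nn_integral_cmult[symmetric]) (auto simp: ennreal_mult less_imp_le)
  qed
  let ?e = "\<lambda>y::real. ennreal (exp (- (\<epsilon> / \<Delta>) * \<bar>y\<bar>))"
  let ?E = "integral\<^sup>N lborel ?e"
  have "I \<le> (\<integral>\<^sup>+ x. ennreal (exp \<epsilon>) * (?e (fst x) * ?e (snd x)) \<partial>lborel)"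
    unfolding I_def using staircase_fun_le[OF assms]
    by (intro nn_integral_mono) (auto simp: ennreal_mult[symmetric] intro!: ennreal_leI)
  also have "\<dots> = ennreal (exp \<epsilon>) * (?E * ?E)"
    by (subst lborel_prod[symmetric], subst lborel.nn_integral_fst[symmetric])
       (simp_all add: nn_integral_cmult nn_integral_multc)
  also have "\<dots> < \<infinity>"
    using nn_integral_exp_abs_finite[of "\<epsilon> / \<Delta>"] assms by (simp add: ennreal_mult_less_top)
  finally have fin: "I < \<infinity>" .
  have "I \<noteq> 0"
  proof
    assume "I = 0"
    then have "AE x in lborel. ennreal (?s 1 x) = 0"
      unfolding I_def by (subst (asm) nn_integral_0_iff_AE) auto
    then have "AE x in (lborel :: (real \<times> real) measure). False"
      using pos by (simp add: ennreal_eq_0_iff not_le[symmetric])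
    then have "emeasure lborel (UNIV :: (real \<times> real) set) = 0"
      by (subst (asm) AE_iff_measurable[of UNIV]) auto
    then show False by (simp add: emeasure_lborel_UNIV)
  qed
  with fin obtain i where i: "I = ennreal i" "0 < i"
    by (cases I) auto
  show ?thesis
  proof (intro ex1I conjI)
    show "0 < 1 / i" using i by simp
    then show "(\<integral>\<^sup>+ x. ennreal (?s (1 / i) x) \<partial>lborel) = 1"
      using i by (simp add: scale ennreal_mult[symmetric])
  next
    fix a assume a: "0 < a \<and> (\<integral>\<^sup>+ x. ennreal (?s a x) \<partial>lborel) = 1"
    then have "ennreal (a * i) = 1" using i scale[of a] by (simp add: ennreal_mult)
    then have "a * i = 1" by simp
    then show "a = 1 / i" using i by (simp add: field_simps)
  qed
qed

end

theory Submission
  imports Defs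
begin

text \<open>Mollifying \<open>P\<close> and averaging its density over \<open>l1\<close>-spheres reduces the lower bound to one
  dimension. In units of \<open>\<Delta>\<close> and with \<open>b = exp (- \<epsilon>)\<close>, let \<open>g\<close> be a radial profile with
  \<open>b * g r \<le> g r'\<close> whenever \<open>\<bar>r - r'\<bar> \<le> 1\<close>, and let \<open>V\<close> be a lower bound for the cost of all staircases.
  The claim is that \<open>r * (r - V) * g r\<close> has nonnegative integral. Split the half line into the
  chains \<open>u, u + 1, u + 2, \<dots>\<close> with \<open>u \<in> {0..<1}\<close>. On one chain \<open>g\<close> may be replaced by a geometric
  sequence of ratio \<open>b\<close> agreeing with \<open>g\<close> at a point of the chain near \<open>V\<close>, which leaves a multiple of
  \<open>\<phi> u = (\<Sum>k. b ^ k * (u + k) * (u + k - V))\<close>. This \<open>\<phi>\<close> is a convex quadratic with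
  \<open>\<phi> 0 = b * \<phi> 1\<close>. If it is negative somewhere in \<open>{0..1}\<close>, it has roots \<open>r1 < r2\<close> there, and comparing
  the multiples for different \<open>u\<close> bounds the integral below by a multiple of that of the
  staircase with \<open>\<gamma> = r2\<close>, which is nonnegative by the choice of \<open>V\<close>.\<close>

section \<open>The one-dimensional problem\<close>

text \<open>The moments of the geometric sequence \<open>b ^ k\<close> on the chain
  \<open>u + k\<close>. Since the area element contributes one factor of the radius,
  \<open>p = 1\<close> measures mass and \<open>p = 2\<close> cost. The convention
  \<open>0 ^ 0 = 1\<close> makes \<open>ladder_sum 0 b 0\<close> the full geometric series.\<close>

definition ladder_sum :: "nat \<Rightarrow> real \<Rightarrow> real \<Rightarrow> real" where
  "ladder_sum p b u = (\<Sum>k. (u + real k) ^ p * b ^ k)"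

lemma summable_ladder:
  fixes b u :: real
  assumes "0 < b" "b < 1"
  shows "summable (\<lambda>k. (u + real k) ^ p * b ^ k)"
proof (rule summable_comparison_test_bigo)
  \<comment> \<open>The ratio \<open>(1 + b) / 2\<close> lies strictly between \<open>b\<close> and
    1, so it absorbs the polynomial factor.\<close>
  show "summable (\<lambda>k. norm (((1 + b) / 2) ^ k))"
    using assms by (simp add: summable_geometric)
  show "(\<lambda>k. (u + real k) ^ p * b ^ k) \<in> O(\<lambda>k. ((1 + b) / 2) ^ k)"
    using assms by real_asymp
qed

text \<open>Removing the first point of a chain leaves the chain from \<open>u + 1\<close>, scaled
  by \<open>b\<close>. At \<open>u = 0\<close> with \<open>p > 0\<close> the removed term vanishes,
  which yields \<open>\<phi> 0 = b * \<phi> 1\<close>.\<close>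

lemma ladder_sum_Suc:
  assumes "0 < b" "b < 1"
  shows "ladder_sum p b u = u ^ p + b * ladder_sum p b (u + 1)"
proof -
  have "(\<Sum>k. (u + real k) ^ p * b ^ k)
      = (\<Sum>k. (u + real (Suc k)) ^ p * b ^ Suc k) + (u + real 0) ^ p * b ^ 0"
    using suminf_split_head[OF summable_ladder[OF assms, of u p]] by simp
  also have "(\<Sum>k. (u + real (Suc k)) ^ p * b ^ Suc k) = b * (\<Sum>k. (u + 1 + real k) ^ p * b ^ k)"
    by (subst suminf_mult[symmetric, OF summable_ladder[OF assms]]) (simp add: algebra_simps)
  finally show ?thesis by (simp add: ladder_sum_def)
qed

lemma ladder_sum_1:
  assumes "0 < b" "b < 1"
  shows "ladder_sum 1 b u = u * ladder_sum 0 b 0 + ladder_sum 1 b 0"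
proof -
  have "ladder_sum 1 b u = (\<Sum>k. u * b ^ k + real k * b ^ k)"
    by (simp add: ladder_sum_def algebra_simps)
  also have "\<dots> = u * (\<Sum>k. b ^ k) + (\<Sum>k. real k * b ^ k)"
    using summable_ladder[OF assms, of 0 0] summable_ladder[OF assms, of 0 1]
    by (subst suminf_add[symmetric]) (simp_all add: suminf_mult summable_mult)
  finally show ?thesis by (simp add: ladder_sum_def)
qed

text \<open>With \<open>ladder_sum_1\<close> this makes \<phi> a quadratic polynomial whose leading
  coefficient \<open>ladder_sum 0 b 0\<close> is positive.\<close>

lemma ladder_sum_2:
  assumes "0 < b" "b < 1"
  shows "ladder_sum 2 b u
    = u\<^sup>2 * ladder_sum 0 b 0 + 2 * u * ladder_sum 1 b 0 + ladder_sum 2 b 0"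
proof -
  have "ladder_sum 2 b u = (\<Sum>k. u\<^sup>2 * b ^ k + (2 * u * (real k * b ^ k) + (real k)\<^sup>2 * b ^ k))"
    by (simp add: ladder_sum_def algebra_simps power2_eq_square)
  also have "\<dots> = u\<^sup>2 * (\<Sum>k. b ^ k) + (2 * u * (\<Sum>k. real k * b ^ k) + (\<Sum>k. (real k)\<^sup>2 * b ^ k))"
    using summable_ladder[OF assms, of 0 0] summable_ladder[OF assms, of 0 1]
      summable_ladder[OF assms, of 0 2]
    by (subst suminf_add[symmetric] suminf_mult[symmetric];
        simp add: summable_mult summable_add del: mult.assoc)+
  finally show ?thesis by (simp add: ladder_sum_def)
qed

lemma ladder_sum_nonneg: "0 \<le> b \<Longrightarrow> 0 \<le> u \<Longrightarrow> b < 1 \<Longrightarrow> 0 \<le> ladder_sum p b u"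
  unfolding ladder_sum_def
  by (cases "b = 0") (auto intro!: suminf_nonneg summable_ladder)

lemma ladder_sum_0_pos:
  assumes "0 < b" "b < 1" 
  shows "0 < ladder_sum 0 b u"
  using assms summable_ladder[OF assms, of u 0] unfolding ladder_sum_def
  by (intro suminf_pos) auto

lemma suminf_ennreal_ladder:
  assumes "0 < b" "b < 1" "0 \<le> u" "0 \<le> c"
  shows "(\<Sum>k. ennreal ((u + real k) ^ p * (c * b ^ k))) = ennreal (c * ladder_sum p b u)"
proof -
  have "summable (\<lambda>k. c * ((u + real k) ^ p * b ^ k))"
    using summable_ladder[OF assms(1,2)] by (rule summable_mult)
  then have "summable (\<lambda>k. (u + real k) ^ p * (c * b ^ k))" by (simp add: mult_ac)
  then have "(\<Sum>k. ennreal ((u + real k) ^ p * (c * b ^ k))) = ennreal (\<Sum>k. (u + real k) ^ p * (c * b ^ k))"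
    using assms by (intro suminf_ennreal2) auto
  also have "(\<Sum>k. (u + real k) ^ p * (c * b ^ k)) = c * ladder_sum p b u"
    unfolding ladder_sum_def
    by (subst suminf_mult[symmetric, OF summable_ladder[OF assms(1,2)]]) (simp add: mult_ac)
  finally show ?thesis .
qed

section \<open>Profiles of bounded decay and their geometric comparison sequences\<close>

definition slow_decay :: "real \<Rightarrow> (real \<Rightarrow> real) \<Rightarrow> bool" where
  "slow_decay b g \<longleftrightarrow>
     (\<forall>r r'. 0 \<le> r \<longrightarrow> 0 \<le> r' \<longrightarrow> \<bar>r - r'\<bar> \<le> 1 \<longrightarrow> b * g r \<le> g r')"

lemma slow_decayD:
  "slow_decay b g \<Longrightarrow> 0 \<le> r \<Longrightarrow> 0 \<le> r' \<Longrightarrow> \<bar>r - r'\<bar> \<le> 1 \<Longrightarrow> b * g r \<le> g r'"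
  unfolding slow_decay_def by blast

lemma slow_decay_iterate:
  assumes "0 < b" and "0 \<le> r" and g: "slow_decay b g"
  shows "b ^ j * g r \<le> g (r + real j)"
proof (induction j)
  case (Suc j)
  have "b * (b ^ j * g r) \<le> b * g (r + real j)"
    using Suc assms by simp
  also have "\<dots> \<le> g (r + real (Suc j))" using assms by (intro slow_decayD[OF g]) auto
  finally show ?case by (simp add: mult_ac)
qed simp

text \<open>The quantity \<open>c * b ^ k\<close> is the geometric sequence through the value of \<open>g\<close> at the anchor
  \<open>u + N\<close>. Since \<open>g\<close> decays at most geometrically, replacing \<open>g (u + k)\<close> by it increases \<open>g\<close>
  below \<open>V\<close> and decreases it above \<open>V\<close>. The inequality is written without subtraction so that it
  can be summed in \<^typ>\<open>ennreal\<close>.\<close>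

lemma anchor_term:
  fixes g :: "real \<Rightarrow> real"
  assumes b: "0 < b" and u: "0 \<le> u"
    and g: "slow_decay b g"
    and N: "u + real N - 1 \<le> V" "V \<le> u + real N + 1"
    and c: "c = g (u + real N) / b ^ N"
  shows "V * ((u + real k) * g (u + real k)) + (u + real k)\<^sup>2 * (c * b ^ k)
     \<le> (u + real k)\<^sup>2 * g (u + real k) + V * ((u + real k) * (c * b ^ k))"
proof -
  \<comment> \<open>The factors agree in sign: the anchor is within 1 of \<open>V\<close>, so
    earlier points of the chain are at most \<open>V\<close> and later ones at least
    \<open>V\<close>, while at the anchor the second factor is 0.\<close>
  have "0 \<le> (u + real k - V) * (g (u + real k) - c * b ^ k)"
  proof (cases k N rule: linorder_cases)
    case less
    then obtain j where j: "N = k + j" "0 < j" using less_imp_add_positive by blast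
    have "b ^ j * g (u + real k) \<le> g (u + real k + real j)"
      using slow_decay_iterate[OF b _ g] u by auto
    then have "g (u + real k) \<le> c * b ^ k"
      using b by (simp add: c j power_add field_simps)
    moreover have "u + real k \<le> V" using N j by simp
    ultimately show ?thesis by (intro mult_nonpos_nonpos) auto
  next
    case equal
    then show ?thesis using b by (simp add: c)
  next
    case greater
    then obtain j where j: "k = N + j" "0 < j" using less_imp_add_positive by blast
    have "b ^ j * g (u + real N) \<le> g (u + real N + real j)"
      using slow_decay_iterate[OF b _ g] u by auto
    then have "c * b ^ k \<le> g (u + real k)"
      using b by (simp add: c j power_add field_simps)
    moreover have "V \<le> u + real k" using N j by simp
    ultimately show ?thesis by (intro mult_nonneg_nonneg) auto
  qed
  then have "0 \<le> (u + real k) * ((u + real k - V) * (g (u + real k) - c * b ^ k))"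
    using u by simp
  then show ?thesis by (simp add: algebra_simps power2_eq_square)
qed

text \<open>One period of the staircase in units of \<Delta>, scaled to height 1 on its upper step;
  the \<open>k\<close>-th period carries an extra factor \<open>b ^ k\<close>.\<close>

definition step_weight :: "real \<Rightarrow> real \<Rightarrow> real \<Rightarrow> real" where
  "step_weight b \<gamma> u = (if u < \<gamma> then 1 else b)"

text \<open>Summing \<open>anchor_term\<close> compares \<open>g\<close> with the geometric sequence
  of factor \<open>c = g (u + N) / b ^ N\<close>. The last hypothesis then permits passing from
  \<open>c\<close> to \<open>m\<close>, whichever sign \<phi> has at \<open>u\<close>.\<close>

lemma anchor_sum:
  fixes g :: "real \<Rightarrow> real"
  assumes b: "0 < b" "b < 1" and u: "0 \<le> u" and V: "0 \<le> V"
    and g: "slow_decay b g"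
    and g0: "\<And>r. 0 \<le> g r"
    and N: "u + real N - 1 \<le> V" "V \<le> u + real N + 1"
    and m: "0 \<le> m"
      "m * (ladder_sum 2 b u - V * ladder_sum 1 b u)
       \<le> g (u + real N) / b ^ N * (ladder_sum 2 b u - V * ladder_sum 1 b u)"
  shows "ennreal V * (\<Sum>k. ennreal ((u + real k) * g (u + real k))) + ennreal (m * ladder_sum 2 b u)
     \<le> (\<Sum>k. ennreal ((u + real k)\<^sup>2 * g (u + real k))) + ennreal V * ennreal (m * ladder_sum 1 b u)"
proof -
  define c where "c = g (u + real N) / b ^ N"
  have c0: "0 \<le> c" using g0 b by (simp add: c_def)
  define A B where "A = (\<Sum>k. ennreal ((u + real k)\<^sup>2 * g (u + real k)))"
    and "B = (\<Sum>k. ennreal ((u + real k) * g (u + real k)))"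
  define s t where "s = ladder_sum 2 b u" and "t = ladder_sum 1 b u"
  have st: "0 \<le> s" "0 \<le> t" using b u by (auto simp: s_def t_def ladder_sum_nonneg)
  have "(\<Sum>k. ennreal V * ennreal ((u + real k) * g (u + real k)) + ennreal ((u + real k)\<^sup>2 * (c * b ^ k)))
    \<le> (\<Sum>k. ennreal ((u + real k)\<^sup>2 * g (u + real k)) + ennreal V * ennreal ((u + real k) ^ 1 * (c * b ^ k)))"
  proof (intro suminf_le allI summableI)
    fix k
    show "ennreal V * ennreal ((u + real k) * g (u + real k)) + ennreal ((u + real k)\<^sup>2 * (c * b ^ k))
      \<le> ennreal ((u + real k)\<^sup>2 * g (u + real k)) + ennreal V * ennreal ((u + real k) ^ 1 * (c * b ^ k))"
      using anchor_term[OF b(1) u g N c_def, of k] V g0 u b c0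
      by (simp add: ennreal_mult[symmetric] ennreal_plus[symmetric] del: ennreal_plus)
  qed
  then have 1: "ennreal V * B + ennreal (c * s) \<le> A + ennreal V * ennreal (c * t)"
    unfolding suminf_add[OF summableI summableI, symmetric] ennreal_suminf_cmult
      suminf_ennreal_ladder[OF b u c0]
    by (simp add: A_def B_def s_def t_def)
  have 2: "m * s + c * (V * t) \<le> c * s + m * (V * t)"
    using m(2) unfolding c_def[symmetric] s_def[symmetric] t_def[symmetric] by (simp add: algebra_simps)
  \<comment> \<open>The same finite amount is added on both sides, so that \<open>1\<close> and
    \<open>2\<close> can be added up and the amount cancelled even when the sums over
    \<open>g\<close> are infinite.\<close>
  have "(ennreal V * B + ennreal (m * s)) + ennreal (c * s + c * (V * t))
     = (ennreal V * B + ennreal (c * s)) + ennreal (m * s + c * (V * t))"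
    using m(1) c0 V st by (simp add: ac_simps)
  also have "\<dots> \<le> (A + ennreal V * ennreal (c * t)) + ennreal (c * s + m * (V * t))"
    by (rule add_mono[OF 1 ennreal_leI[OF 2]])
  also have "\<dots> = (A + ennreal V * ennreal (m * t)) + ennreal (c * s + c * (V * t))"
    using m(1) c0 V st by (simp add: ac_simps ennreal_mult[symmetric])
  finally show ?thesis
    unfolding A_def[symmetric] B_def[symmetric] s_def[symmetric] t_def[symmetric]
    by (simp add: ennreal_add_left_cancel_le add.commute[of _ "ennreal (c * s + c * (V * t))"])
qed

text \<open>The intermediate value theorem yields a root on either side of \<open>x\<close>;
  subtracting the two root equations determines \<open>p\<close>, and then \<open>q\<close>.\<close>

lemma quadratic_roots_unit_interval:
  fixes s p q x :: real
  assumes s: "0 < s" and x: "0 \<le> x" "x \<le> 1" and neg: "s * x\<^sup>2 + p * x + q < 0"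
    and ends: "0 \<le> q" "0 \<le> s + p + q"
  obtains r1 r2 where "0 \<le> r1" "r1 < r2" "r2 \<le> 1"
    "\<And>u. s * u\<^sup>2 + p * u + q = s * ((u - r1) * (u - r2))"
proof -
  let ?f = "\<lambda>u. s * u\<^sup>2 + p * u + q"
  obtain r1 where r1: "0 \<le> r1" "r1 \<le> x" "?f r1 = 0"
    using IVT2'[of ?f x 0 0] neg ends x by (force intro!: continuous_intros)
  obtain r2 where r2: "x \<le> r2" "r2 \<le> 1" "?f r2 = 0"
    using IVT'[of ?f x 0 1] neg ends x by (force intro!: continuous_intros)
  have ne: "r1 < r2" using r1 r2 neg by (cases "r1 = r2") auto
  have "(r2 - r1) * (s * (r1 + r2) + p) = ?f r2 - ?f r1"
    by (simp add: algebra_simps power2_eq_square)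
  also have "\<dots> = 0" using r1(3) r2(3) by simp
  finally have p: "p = - s * (r1 + r2)" using ne by simp
  have q: "q = s * r1 * r2" using r1(3) unfolding p by (simp add: algebra_simps power2_eq_square)
  show thesis
  proof (rule that[OF r1(1) ne r2(2)])
    show "?f u = s * ((u - r1) * (u - r2))" for u
      unfolding p q by (simp add: algebra_simps power2_eq_square)
  qed
qed

text \<open>The free choice of the anchor is what makes a comparison with the supremum \<open>S\<close> of \<open>g\<close> over the
  interval \<open>n + {r1..r2}\<close> possible although \<open>g\<close> need not be monotone: an offset \<open>u < r1\<close> is anchored
  at \<open>u + n + 1\<close>, the others at \<open>u + n\<close>, and all anchors are within distance 1 of that interval.\<close>

lemma anchors_exist:
  fixes g :: "real \<Rightarrow> real"
  assumes b: "0 < b" "b < 1" and V: "0 \<le> V"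
    and g: "slow_decay b g" and g0: "\<And>r. 0 \<le> g r" and gK: "\<And>r. g r \<le> K"
  defines "\<phi> \<equiv> \<lambda>u. ladder_sum 2 b u - V * ladder_sum 1 b u"
  assumes ends: "0 \<le> \<phi> 0" "0 \<le> \<phi> 1"
  obtains \<gamma> M where "0 \<le> \<gamma>" "\<gamma> \<le> 1" "0 \<le> M"
    "\<And>u. 0 \<le> u \<Longrightarrow> u < 1 \<Longrightarrow> \<exists>N. u + real N - 1 \<le> V \<and> V \<le> u + real N + 1 \<and>
       M * step_weight b \<gamma> u * \<phi> u \<le> g (u + real N) / b ^ N * \<phi> u"
proof (cases "\<exists>x. 0 \<le> x \<and> x \<le> 1 \<and> \<phi> x < 0")
  case False
  have "\<exists>N. u + real N - 1 \<le> V \<and> V \<le> u + real N + 1 \<and>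
       0 * step_weight b 0 u * \<phi> u \<le> g (u + real N) / b ^ N * \<phi> u" if "0 \<le> u" "u < 1" for u
  \<comment> \<open>Rounding up, with truncation at 0, stays within 1 of \<open>V\<close>; when
    \<open>V < u\<close> this holds because \<open>u < 1\<close>.\<close>
  proof (intro exI[of _ "nat \<lceil>V - u\<rceil>"] conjI)
    show "u + real (nat \<lceil>V - u\<rceil>) - 1 \<le> V" "V \<le> u + real (nat \<lceil>V - u\<rceil>) + 1"
      using that V by linarith+
    have "0 \<le> \<phi> u" using False that by (meson less_imp_le not_less)
    then show "0 * step_weight b 0 u * \<phi> u \<le> g (u + real (nat \<lceil>V - u\<rceil>)) / b ^ nat \<lceil>V - u\<rceil> * \<phi> u"
      using g0 b by simp
  qed
  then show thesis by (intro that[of 0 0]) auto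
next
  case True
  then obtain x where x: "0 \<le> x" "x \<le> 1" "\<phi> x < 0" by blast
  define s where "s = ladder_sum 0 b 0"
  define p where "p = 2 * ladder_sum 1 b 0 - V * s"
  define q where "q = ladder_sum 2 b 0 - V * ladder_sum 1 b 0"
  have s: "0 < s" using b by (simp add: s_def ladder_sum_0_pos)
  have \<phi>: "\<phi> u = s * u\<^sup>2 + p * u + q" for u
    unfolding \<phi>_def s_def p_def q_def ladder_sum_1[OF b, of u] ladder_sum_2[OF b, of u]
    by (simp add: algebra_simps)
  obtain r1 r2 where r: "0 \<le> r1" "r1 < r2" "r2 \<le> 1" and
    fac: "\<And>u. s * u\<^sup>2 + p * u + q = s * ((u - r1) * (u - r2))"
    using quadratic_roots_unit_interval[OF s x(1,2), of p q] x(3) ends unfolding \<phi>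
    by (auto simp: algebra_simps)
  \<comment> \<open>For \<open>u > V\<close> all terms \<open>(u + k) * (u + k - V) * b ^ k\<close>
    are positive, so \<phi> has no root beyond \<open>V\<close>.\<close>
  have "r1 \<le> V"
  proof (rule ccontr)
    assume "\<not> r1 \<le> V"
    then have "V < r1" by simp
    then have "0 < (r1 - V) * (r1 * s)" using V s by simp
    moreover have "0 \<le> (r1 - V) * ladder_sum 1 b 0" "0 \<le> r1 * ladder_sum 1 b 0" "0 \<le> ladder_sum 2 b 0"
      using \<open>V < r1\<close> r b by (auto intro!: mult_nonneg_nonneg ladder_sum_nonneg)
    moreover have "\<phi> r1 = (r1 - V) * (r1 * s) + (r1 - V) * ladder_sum 1 b 0
        + r1 * ladder_sum 1 b 0 + ladder_sum 2 b 0"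
      unfolding \<phi> p_def q_def by (simp add: algebra_simps power2_eq_square)
    moreover have "\<phi> r1 = 0" unfolding \<phi> fac by simp
    ultimately show False by linarith
  qed
  \<comment> \<open>This puts \<open>r1 + n\<close> into the unit interval ending at
    \<open>V\<close>. Hence \<open>u + n\<close> for \<open>r1 \<le> u\<close> and
    \<open>u + n + 1\<close> for \<open>u < r1\<close> are within 1 of \<open>V\<close>.\<close>
  define n where "n = nat \<lfloor>V - r1\<rfloor>"
  have n: "r1 + real n \<le> V" "V \<le> r1 + real n + 1"
    using \<open>r1 \<le> V\<close> unfolding n_def by linarith+
  define S where "S = (SUP u\<in>{r1..r2}. g (u + real n))"
  have bdd: "bdd_above ((\<lambda>u. g (u + real n)) ` {r1..r2})"
    using gK by (auto simp: bdd_above_def)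
  have S_upper: "g (u + real n) \<le> S" if "r1 \<le> u" "u \<le> r2" for u
    unfolding S_def using that bdd by (intro cSUP_upper) auto
  have S_least: "S \<le> z" if "\<And>u. r1 \<le> u \<Longrightarrow> u \<le> r2 \<Longrightarrow> g (u + real n) \<le> z" for z
    unfolding S_def using that r by (intro cSUP_least) auto
  have S0: "0 \<le> S" using S_upper[of r1] g0[of "r1 + real n"] r by linarith
  show thesis
  \<comment> \<open>The weight drops at the larger root. On \<open>{r1..r2}\<close>, where
    \<open>\<phi> \<le> 0\<close>, \<open>S\<close> bounds \<open>g\<close> from above. Outside,
    where \<open>\<phi> \<ge> 0\<close>, comparison with \<open>S\<close> costs a factor
    \<open>b\<close>, which is made up by the anchor \<open>Suc n\<close> on the left and by the
    weight \<open>b\<close> on the right.\<close>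
  proof (rule that[of r2 "S / b ^ n"])
    fix u :: real assume u: "0 \<le> u" "u < 1"
    consider (left) "u < r1" | (mid) "r1 \<le> u" "u \<le> r2" | (right) "r2 < u" by linarith
    then show "\<exists>N. u + real N - 1 \<le> V \<and> V \<le> u + real N + 1 \<and>
       S / b ^ n * step_weight b r2 u * \<phi> u \<le> g (u + real N) / b ^ N * \<phi> u"
    proof cases
      case left
      have "S \<le> g (u + real (Suc n)) / b"
      proof (rule S_least)
        fix v assume "r1 \<le> v" "v \<le> r2"
        then have "b * g (v + real n) \<le> g (u + real (Suc n))"
          using u r left by (intro slow_decayD[OF g]) auto
        then show "g (v + real n) \<le> g (u + real (Suc n)) / b" using b by (simp add: field_simps)
      qed
      then have "S / b ^ n \<le> g (u + real (Suc n)) / b ^ Suc n"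
        using b by (simp add: field_simps)
      moreover have "0 \<le> \<phi> u" unfolding \<phi> fac using left r s
        by (intro mult_nonneg_nonneg mult_nonpos_nonpos) auto
      ultimately have "S / b ^ n * \<phi> u \<le> g (u + real (Suc n)) / b ^ Suc n * \<phi> u"
        by (rule mult_right_mono)
      then show ?thesis using n u left r
        by (intro exI[of _ "Suc n"]) (auto simp: step_weight_def)
    next
      case mid
      have "\<phi> u \<le> 0" unfolding \<phi> fac using mid s
        by (intro mult_nonneg_nonpos mult_nonneg_nonpos) auto
      moreover have "g (u + real n) / b ^ n \<le> S / b ^ n"
        using S_upper mid b by (intro divide_right_mono) auto
      ultimately have "S / b ^ n * \<phi> u \<le> g (u + real n) / b ^ n * \<phi> u"
        by (intro mult_right_mono_neg)
      \<comment> \<open>At \<open>u = r2\<close> the weight is already \<open>b\<close>, but \<phi>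
        vanishes there.\<close>
      moreover have "step_weight b r2 u * \<phi> u = \<phi> u"
        using mid unfolding \<phi> fac by (cases "u = r2") (auto simp: step_weight_def)
      ultimately show ?thesis using n u mid r
        by (intro exI[of _ n]) (auto simp: mult.assoc)
    next
      case right
      have "S \<le> g (u + real n) / b"
      proof (rule S_least)
        fix v assume "r1 \<le> v" "v \<le> r2"
        then have "b * g (v + real n) \<le> g (u + real n)"
          using u r right by (intro slow_decayD[OF g]) auto
        then show "g (v + real n) \<le> g (u + real n) / b" using b by (simp add: field_simps)
      qed
      then have "S / b ^ n * b \<le> g (u + real n) / b ^ n"
        using b by (simp add: field_simps)
      moreover have "0 \<le> \<phi> u" unfolding \<phi> fac using right r s
        by (intro mult_nonneg_nonneg) auto
      ultimately have "S / b ^ n * b * \<phi> u \<le> g (u + real n) / b ^ n * \<phi> u"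
        by (rule mult_right_mono)
      then show ?thesis using n u right r
        by (intro exI[of _ n]) (auto simp: step_weight_def)
    qed
  qed (use r S0 b in auto)
qed

section \<open>Integration over the offsets of the chains\<close>

lemma measurable_ladder_sum [measurable]:
  assumes "0 < b" "b < 1"
  shows "ladder_sum p b \<in> borel_measurable borel"
  unfolding ladder_sum_def by measurable

text \<open>Integrating \<open>anchor_sum\<close> over the offsets reduces the claim to the
  hypothesis \<open>stair\<close> for a single \<gamma>. Subtraction is avoided because the moments
  of \<open>g\<close> may be infinite; those of the staircases are finite and can be
  cancelled.\<close>

lemma ladder_minimum:
  fixes g :: "real \<Rightarrow> real"
  assumes b: "0 < b" "b < 1" and V: "0 \<le> V"
    and g: "slow_decay b g" and g0: "\<And>r. 0 \<le> g r" and gK: "\<And>r. g r \<le> K"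
    and meas [measurable]: "g \<in> borel_measurable borel"
    and stair: "\<And>\<gamma>. 0 \<le> \<gamma> \<Longrightarrow> \<gamma> \<le> 1 \<Longrightarrow>
      ennreal V * (\<integral>\<^sup>+u\<in>{0..<1}. ennreal (step_weight b \<gamma> u * ladder_sum 1 b u) \<partial>lborel)
        \<le> (\<integral>\<^sup>+u\<in>{0..<1}. ennreal (step_weight b \<gamma> u * ladder_sum 2 b u) \<partial>lborel)"
  shows "ennreal V * (\<integral>\<^sup>+u\<in>{0..<1}. (\<Sum>k. ennreal ((u + real k) * g (u + real k))) \<partial>lborel)
    \<le> (\<integral>\<^sup>+u\<in>{0..<1}. (\<Sum>k. ennreal ((u + real k)\<^sup>2 * g (u + real k))) \<partial>lborel)"
proof -
  have [measurable]: "ladder_sum p b \<in> borel_measurable borel" for p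
    using b by measurable
  have [measurable]: "step_weight b \<gamma> \<in> borel_measurable borel" for \<gamma>
    unfolding step_weight_def by measurable
  have mono: "ladder_sum p b u \<le> ladder_sum p b 1" if "0 \<le> u" "u \<le> 1" for p u
    unfolding ladder_sum_def using b that
    by (intro suminf_le allI mult_right_mono power_mono summable_ladder[OF b]) auto
  have fin: "(\<integral>\<^sup>+u\<in>{0..<1}. ennreal (step_weight b \<gamma> u * ladder_sum p b u) \<partial>lborel) < \<infinity>" for \<gamma> p
  proof -
    have "(\<integral>\<^sup>+u\<in>{0..<1}. ennreal (step_weight b \<gamma> u * ladder_sum p b u) \<partial>lborel)
      \<le> (\<integral>\<^sup>+u. ennreal (ladder_sum p b 1) * indicator {0..<1::real} u \<partial>lborel)"
    proof (intro nn_integral_mono)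
      fix u
      have "step_weight b \<gamma> u * ladder_sum p b u \<le> 1 * ladder_sum p b 1" if "0 \<le> u" "u < 1"
        using b mono[of u p] that by (intro mult_mono ladder_sum_nonneg) (auto simp: step_weight_def)
      then show "ennreal (step_weight b \<gamma> u * ladder_sum p b u) * indicator {0..<1} u
        \<le> ennreal (ladder_sum p b 1) * indicator {0..<1} u"
        by (auto simp: indicator_def intro!: ennreal_leI)
    qed
    also have "\<dots> < \<infinity>" by (simp add: nn_integral_cmult)
    finally show ?thesis .
  qed
  define \<phi> where "\<phi> u = ladder_sum 2 b u - V * ladder_sum 1 b u" for u
  have \<phi>_shift: "\<phi> 0 = b * \<phi> 1"
    using ladder_sum_Suc[OF b, of 1 0] ladder_sum_Suc[OF b, of 2 0]
    by (simp add: \<phi>_def algebra_simps)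
  \<comment> \<open>Otherwise \<open>\<phi>\<close>, being convex, would be negative on all of \<open>{0..1}\<close>, against \<open>stair\<close> for \<open>\<gamma> = 1\<close>.\<close>
  have "0 \<le> \<phi> 1"
  proof (rule ccontr)
    assume "\<not> 0 \<le> \<phi> 1"
    then have neg: "\<phi> 1 < 0" by simp
    define s where "s = ladder_sum 0 b 0"
    have below: "\<phi> u \<le> b * \<phi> 1" if u: "0 \<le> u" "u \<le> 1" for u
    proof -
      \<comment> \<open>A quadratic with leading coefficient \<open>s\<close> lies below its chord
        over \<open>{0..1}\<close> by exactly \<open>s * (u * (1 - u))\<close>.\<close>
      have "\<phi> u = (1 - u) * \<phi> 0 + u * \<phi> 1 - s * (u * (1 - u))"
        unfolding \<phi>_def s_def ladder_sum_1[OF b, of u] ladder_sum_2[OF b, of u]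
          ladder_sum_1[OF b, of 1] ladder_sum_2[OF b, of 1]
        by (simp add: algebra_simps power2_eq_square)
      also have "\<dots> \<le> (1 - u) * (b * \<phi> 1) + u * (b * \<phi> 1)"
      proof -
        have "1 * \<phi> 1 \<le> b * \<phi> 1" using neg b by (intro mult_right_mono_neg) auto
        then have "u * \<phi> 1 \<le> u * (b * \<phi> 1)" using u by (intro mult_left_mono) auto
        moreover have "0 \<le> s * (u * (1 - u))"
          using u b unfolding s_def by (intro mult_nonneg_nonneg ladder_sum_nonneg) auto
        ultimately show ?thesis using \<phi>_shift by simp
      qed
      finally show ?thesis by (simp add: algebra_simps)
    qed
    let ?I = "\<lambda>p. \<integral>\<^sup>+u\<in>{0..<1}. ennreal (step_weight b 1 u * ladder_sum p b u) \<partial>lborel"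
    have pos: "0 < - (b * \<phi> 1)" using neg b by (simp add: mult_pos_neg)
    have "?I 2 + ennreal (- (b * \<phi> 1))
      = (\<integral>\<^sup>+u\<in>{0..<1}. (ennreal (step_weight b 1 u * ladder_sum 2 b u) + ennreal (- (b * \<phi> 1))) \<partial>lborel)"
      by (simp add: nn_integral_add nn_integral_cmult distrib_right)
    also have "\<dots> \<le> (\<integral>\<^sup>+u\<in>{0..<1}. (ennreal V * ennreal (step_weight b 1 u * ladder_sum 1 b u)) \<partial>lborel)"
    proof (intro nn_integral_mono)
      fix u :: real
      have "ennreal (ladder_sum 2 b u) + ennreal (- (b * \<phi> 1)) \<le> ennreal V * ennreal (ladder_sum 1 b u)"
        if u: "0 \<le> u" "u < 1"
        using below[of u] u b V pos
        by (simp add: \<phi>_def[of u] ennreal_mult[symmetric] ennreal_plus[symmetric] ladder_sum_nonneg del: ennreal_plus)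
      then show "(ennreal (step_weight b 1 u * ladder_sum 2 b u) + ennreal (- (b * \<phi> 1))) * indicator {0..<1} u
        \<le> ennreal V * ennreal (step_weight b 1 u * ladder_sum 1 b u) * indicator {0..<1} u"
        by (auto simp: indicator_def step_weight_def)
    qed
    also have "\<dots> = ennreal V * ?I 1" by (simp add: nn_integral_cmult mult.assoc)
    also have "\<dots> \<le> ?I 2" using stair[of 1] by simp
    finally show False
      using fin[of 1 2] pos ennreal_add_left_cancel_le[of "?I 2" "ennreal (- (b * \<phi> 1))" 0]
      by (auto simp: ennreal_eq_0_iff)
  qed
  moreover from this have "0 \<le> \<phi> 0" using \<phi>_shift b by simp
  ultimately obtain \<gamma> M where \<gamma>: "0 \<le> \<gamma>" "\<gamma> \<le> 1" and M: "0 \<le> M" and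
    anchor: "\<And>u. 0 \<le> u \<Longrightarrow> u < 1 \<Longrightarrow> \<exists>N. u + real N - 1 \<le> V \<and> V \<le> u + real N + 1 \<and>
       M * step_weight b \<gamma> u * \<phi> u \<le> g (u + real N) / b ^ N * \<phi> u"
    using anchors_exist[OF b V g g0 gK] unfolding \<phi>_def by blast
  define A B where "A u = (\<Sum>k. ennreal ((u + real k)\<^sup>2 * g (u + real k)))"
    and "B u = (\<Sum>k. ennreal ((u + real k) * g (u + real k)))" for u
  have [measurable]: "A \<in> borel_measurable borel" "B \<in> borel_measurable borel"
    unfolding A_def B_def by measurable
  define s t where "s = (\<integral>\<^sup>+u\<in>{0..<1}. ennreal (step_weight b \<gamma> u * ladder_sum 2 b u) \<partial>lborel)"
    and "t = (\<integral>\<^sup>+u\<in>{0..<1}. ennreal (step_weight b \<gamma> u * ladder_sum 1 b u) \<partial>lborel)"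
  have pt: "ennreal V * B u + ennreal M * ennreal (step_weight b \<gamma> u * ladder_sum 2 b u)
     \<le> A u + ennreal V * (ennreal M * ennreal (step_weight b \<gamma> u * ladder_sum 1 b u))"
    if u: "0 \<le> u" "u < 1" for u
  proof -
    obtain N where N: "u + real N - 1 \<le> V" "V \<le> u + real N + 1"
      "M * step_weight b \<gamma> u * \<phi> u \<le> g (u + real N) / b ^ N * \<phi> u"
      using anchor[OF u] by blast
    have "0 \<le> M * step_weight b \<gamma> u" using M b by (simp add: step_weight_def)
    from anchor_sum[OF b u(1) V g g0 N(1,2) this N(3)[unfolded \<phi>_def]]
    show ?thesis using M by (simp add: A_def B_def ennreal_mult' mult.assoc)
  qed
  have "ennreal V * (\<integral>\<^sup>+u\<in>{0..<1}. B u \<partial>lborel) + ennreal M * s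
    = (\<integral>\<^sup>+u\<in>{0..<1}. (ennreal V * B u + ennreal M * ennreal (step_weight b \<gamma> u * ladder_sum 2 b u)) \<partial>lborel)"
    unfolding s_def by (simp add: nn_integral_add nn_integral_cmult distrib_right mult.assoc)
  also have "\<dots> \<le> (\<integral>\<^sup>+u\<in>{0..<1}. (A u + ennreal V * (ennreal M * ennreal (step_weight b \<gamma> u * ladder_sum 1 b u))) \<partial>lborel)"
    using pt by (intro nn_integral_mono) (auto simp: indicator_def)
  also have "\<dots> = (\<integral>\<^sup>+u\<in>{0..<1}. A u \<partial>lborel) + ennreal M * (ennreal V * t)"
    unfolding t_def by (simp add: nn_integral_add nn_integral_cmult distrib_right mult.assoc mult.left_commute)
  also have "\<dots> \<le> (\<integral>\<^sup>+u\<in>{0..<1}. A u \<partial>lborel) + ennreal M * s"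
    using stair[OF \<gamma>] unfolding s_def t_def by (intro add_left_mono mult_left_mono) auto
  finally show ?thesis
    using fin[of \<gamma> 2] unfolding A_def B_def s_def[symmetric]
    by (auto simp: ennreal_add_left_cancel_le add.commute[of _ "ennreal M * s"] ennreal_mult_eq_top_iff)
qed

section \<open>Polar coordinates for the l1-norm\<close>

lemma nn_integral_fold_even:
  fixes h :: "real \<Rightarrow> ennreal"
  assumes [measurable]: "h \<in> borel_measurable borel"
  shows "integral\<^sup>N lborel h = (\<integral>\<^sup>+x\<in>{0..}. (h x + h (- x)) \<partial>lborel)"
proof -
  have "integral\<^sup>N lborel h = (\<integral>\<^sup>+x. h x * indicator {0..} x + h x * indicator {..<0} x \<partial>lborel)"
    by (intro nn_integral_cong) (auto simp: indicator_def)
  also have "\<dots> = (\<integral>\<^sup>+x\<in>{0..}. h x \<partial>lborel) + (\<integral>\<^sup>+x\<in>{..<0}. h x \<partial>lborel)"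
    by (intro nn_integral_add) measurable
  also have "(\<integral>\<^sup>+x\<in>{..<0}. h x \<partial>lborel) = (\<integral>\<^sup>+x. h (- x) * indicator {..<0} (- x) \<partial>lborel)"
    using nn_integral_real_affine[of "\<lambda>x. h x * indicator {..<0} x" "-1" 0] by simp
  \<comment> \<open>The reflected half line differs from \<open>{0..}\<close> only in the null set
    \<open>{0}\<close>.\<close>
  also have "\<dots> = (\<integral>\<^sup>+x\<in>{0..}. h (- x) \<partial>lborel)"
    using AE_lborel_singleton[of "0::real"]
    by (intro nn_integral_cong_AE) (auto simp: indicator_def)
  also have "(\<integral>\<^sup>+x\<in>{0..}. h x \<partial>lborel) + \<dots> = (\<integral>\<^sup>+x\<in>{0..}. (h x + h (- x)) \<partial>lborel)"
    by (subst nn_integral_add[symmetric]) (auto simp: distrib_right)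
  finally show ?thesis .
qed

text \<open>Substitute \<open>y = r - x\<close>, so that \<open>r\<close> is the l1-norm, swap the
  integrals and substitute \<open>x = r * s\<close>; the last step brings in the Jacobian
  \<open>r\<close>.\<close>

lemma nn_integral_quadrant:
  fixes f :: "real \<times> real \<Rightarrow> ennreal"
  assumes f: "f \<in> borel_measurable borel"
  shows "(\<integral>\<^sup>+x\<in>{0..}. (\<integral>\<^sup>+y\<in>{0..}. f (x, y) \<partial>lborel) \<partial>lborel)
    = (\<integral>\<^sup>+r\<in>{0..}. ennreal r * (\<integral>\<^sup>+s\<in>{0..1}. f (r * s, r * (1 - s)) \<partial>lborel) \<partial>lborel)"
proof -
  have [measurable]: "f \<in> borel_measurable (borel \<Otimes>\<^sub>M borel)" using f by (simp add: borel_prod)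
  have shift: "(\<integral>\<^sup>+y\<in>{0..}. f (x, y) \<partial>lborel) = (\<integral>\<^sup>+r\<in>{x..}. f (x, r - x) \<partial>lborel)" for x
    using nn_integral_real_affine[of "\<lambda>y. f (x, y) * indicator {0..} y" 1 "- x"]
    by (auto simp: indicator_def intro!: nn_integral_cong)
  have "(\<integral>\<^sup>+x\<in>{0..}. (\<integral>\<^sup>+y\<in>{0..}. f (x, y) \<partial>lborel) \<partial>lborel)
    = (\<integral>\<^sup>+x. (\<integral>\<^sup>+r. f (x, r - x) * (if 0 \<le> x \<and> x \<le> r then 1 else 0) \<partial>lborel) \<partial>lborel)"
    unfolding shift
    by (subst nn_integral_multc[symmetric]) (auto intro!: nn_integral_cong simp: indicator_def)
  also have "\<dots> = (\<integral>\<^sup>+r. (\<integral>\<^sup>+x. f (x, r - x) * (if 0 \<le> x \<and> x \<le> r then 1 else 0) \<partial>lborel) \<partial>lborel)"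
    by (rule lborel_pair.Fubini') measurable
  also have "\<dots> = (\<integral>\<^sup>+r\<in>{0..}. ennreal r * (\<integral>\<^sup>+s\<in>{0..1}. f (r * s, r * (1 - s)) \<partial>lborel) \<partial>lborel)"
  proof (rule nn_integral_cong_AE, rule AE_mp[OF AE_lborel_singleton[of "0::real"]], rule AE_I2, rule impI)
    fix r :: real assume "r \<noteq> 0"
    then consider "r < 0" | "0 < r" by linarith
    then show "(\<integral>\<^sup>+x. f (x, r - x) * (if 0 \<le> x \<and> x \<le> r then 1 else 0) \<partial>lborel)
      = ennreal r * (\<integral>\<^sup>+s\<in>{0..1}. f (r * s, r * (1 - s)) \<partial>lborel) * indicator {0..} r"
    proof cases
      case 1
      then have "(\<integral>\<^sup>+x. f (x, r - x) * (if 0 \<le> x \<and> x \<le> r then 1 else 0) \<partial>lborel) = (\<integral>\<^sup>+x. 0 \<partial>(lborel :: real measure))"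
        by (intro nn_integral_cong) auto
      then show ?thesis using 1 by simp
    next
      case 2
      then show ?thesis
        by (subst nn_integral_real_affine[where c = r and t = 0])
          (auto intro!: nn_integral_cong arg_cong[where f = "(*) (ennreal r)"] simp: indicator_def right_diff_distrib mult_le_cancel_left1 mult_le_cancel_left2 zero_le_mult_iff)
    qed
  qed
  finally show ?thesis .
qed

text \<open>As \<open>s\<close> runs through \<open>{0..1}\<close>, the four points run through the
  four edges of the l1-sphere of radius \<open>r\<close>. The generic type admits both real and
  \<open>ennreal\<close> values.\<close>

definition l1_sphere_sum :: "(real \<times> real \<Rightarrow> 'a :: ab_semigroup_add) \<Rightarrow> real \<Rightarrow> real \<Rightarrow> 'a" where
  "l1_sphere_sum f r s = f (r * s, r * (1 - s)) + f (r * s, - (r * (1 - s)))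
     + (f (- (r * s), r * (1 - s)) + f (- (r * s), - (r * (1 - s))))"

text \<open>Folding along both axes brings the four quadrants into the first one, where
  \<open>nn_integral_quadrant\<close> applies.\<close>

lemma nn_integral_l1_polar:
  fixes f :: "real \<times> real \<Rightarrow> ennreal"
  assumes f: "f \<in> borel_measurable borel"
  shows "integral\<^sup>N lborel f
    = (\<integral>\<^sup>+r\<in>{0..}. ennreal r * (\<integral>\<^sup>+s\<in>{0..1}. l1_sphere_sum f r s \<partial>lborel) \<partial>lborel)"
proof -
  have [measurable]: "f \<in> borel_measurable (borel \<Otimes>\<^sub>M borel)" using f by (simp add: borel_prod)
  let ?h = "\<lambda>(x, y). f (x, y) + f (x, - y) + (f (- x, y) + f (- x, - y))"
  have "integral\<^sup>N lborel f = (\<integral>\<^sup>+x. (\<integral>\<^sup>+y. f (x, y) \<partial>lborel) \<partial>lborel)"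
    using f lborel.nn_integral_fst[of f lborel] by (simp add: lborel_prod)
  also have "\<dots> = (\<integral>\<^sup>+x. (\<integral>\<^sup>+y\<in>{0..}. (f (x, y) + f (x, - y)) \<partial>lborel) \<partial>lborel)"
    by (subst nn_integral_fold_even) auto
  also have "\<dots> = (\<integral>\<^sup>+x\<in>{0..}. ((\<integral>\<^sup>+y\<in>{0..}. (f (x, y) + f (x, - y)) \<partial>lborel)
      + (\<integral>\<^sup>+y\<in>{0..}. (f (- x, y) + f (- x, - y)) \<partial>lborel)) \<partial>lborel)"
    by (subst nn_integral_fold_even) auto
  also have "\<dots> = (\<integral>\<^sup>+x\<in>{0..}. (\<integral>\<^sup>+y\<in>{0..}. ?h (x, y) \<partial>lborel) \<partial>lborel)"
    by (subst nn_integral_add[symmetric]) (auto simp: distrib_right)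
  also have "\<dots> = (\<integral>\<^sup>+r\<in>{0..}. ennreal r * (\<integral>\<^sup>+s\<in>{0..1}. ?h (r * s, r * (1 - s)) \<partial>lborel) \<partial>lborel)"
    by (rule nn_integral_quadrant) (simp add: borel_prod[symmetric])
  finally show ?thesis by (simp add: l1_sphere_sum_def)
qed

text \<open>After scaling to units of \<Delta>, the intervals \<open>{k..<k + 1}\<close> are moved
  onto \<open>{0..<1}\<close>, so that each offset \<open>u\<close> collects its whole
  chain.\<close>

lemma nn_integral_unroll:
  fixes h :: "real \<Rightarrow> ennreal"
  assumes [measurable]: "h \<in> borel_measurable borel" and \<Delta>: "0 < \<Delta>"
  shows "(\<integral>\<^sup>+r\<in>{0..}. h r \<partial>lborel)
    = ennreal \<Delta> * (\<integral>\<^sup>+u\<in>{0..<1}. (\<Sum>k. h (\<Delta> * (u + real k))) \<partial>lborel)"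
proof -
  have split: "indicator {0..} r = (\<Sum>k. indicator {real k..<real k + 1} r :: ennreal)" for r :: real
  proof (cases "0 \<le> r")
    case True
    have "(\<Sum>k. indicator {real k..<real k + 1} r :: ennreal)
        = (\<Sum>k\<in>{nat \<lfloor>r\<rfloor>}. indicator {real k..<real k + 1} r)"
      using True by (intro suminf_finite) (auto simp: indicator_def, linarith)
    also have "\<dots> = 1" using True by (auto simp: indicator_def)
    finally show ?thesis using True by simp
  next
    case False
    then have "indicator {real k..<real k + 1} r = (0::ennreal)" for k
      by (auto simp: indicator_def)
    then show ?thesis using False by simp
  qed
  have "(\<integral>\<^sup>+r\<in>{0..}. h r \<partial>lborel) = ennreal \<Delta> * (\<integral>\<^sup>+r\<in>{0..}. h (\<Delta> * r) \<partial>lborel)"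
    using \<Delta> by (subst nn_integral_real_affine[where c = \<Delta> and t = 0])
      (auto intro!: nn_integral_cong arg_cong[where f = "(*) (ennreal \<Delta>)"] simp: indicator_def zero_le_mult_iff)
  also have "(\<integral>\<^sup>+r\<in>{0..}. h (\<Delta> * r) \<partial>lborel)
      = (\<integral>\<^sup>+r. (\<Sum>k. h (\<Delta> * r) * indicator {real k..<real k + 1} r) \<partial>lborel)"
    by (simp add: split ennreal_suminf_cmult)
  also have "\<dots> = (\<Sum>k. \<integral>\<^sup>+r\<in>{real k..<real k + 1}. h (\<Delta> * r) \<partial>lborel)"
    by (rule nn_integral_suminf) measurable
  also have "(\<lambda>k. \<integral>\<^sup>+r\<in>{real k..<real k + 1}. h (\<Delta> * r) \<partial>lborel)
      = (\<lambda>k. \<integral>\<^sup>+u. h (\<Delta> * (u + real k)) * indicator {0..<1} u \<partial>lborel)"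
  proof
    fix k
    show "(\<integral>\<^sup>+r\<in>{real k..<real k + 1}. h (\<Delta> * r) \<partial>lborel)
      = (\<integral>\<^sup>+u. h (\<Delta> * (u + real k)) * indicator {0..<1} u \<partial>lborel)"
      by (subst nn_integral_real_affine[where c = 1 and t = "real k"])
        (auto intro!: nn_integral_cong simp: indicator_def add.commute)
  qed
  also have "(\<Sum>k. \<integral>\<^sup>+u. h (\<Delta> * (u + real k)) * indicator {0..<1} u \<partial>lborel)
      = (\<integral>\<^sup>+u. (\<Sum>k. h (\<Delta> * (u + real k)) * indicator {0..<1} u) \<partial>lborel)"
    by (rule nn_integral_suminf[symmetric]) measurable
  finally show ?thesis by (simp add: ennreal_suminf_multc)
qed

section \<open>Radial moments of a density\<close>

lemma measurable_l1norm [measurable]: "l1norm \<in> borel_measurable borel"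
  unfolding l1norm_def borel_prod[symmetric] by measurable

lemma l1norm_nonneg: "0 \<le> l1norm x"
  by (simp add: l1norm_def)

lemma l1norm_triangle: "l1norm (x + y) \<le> l1norm x + l1norm y"
  by (simp add: l1norm_def)

lemma l1_sphere_abs:
  fixes r s :: real
  assumes "0 \<le> r" "0 \<le> s" "s \<le> 1"
  shows "\<bar>r * s\<bar> + \<bar>r * (1 - s)\<bar> = r"
  using assms by (simp add: abs_mult right_diff_distrib[symmetric] distrib_left[symmetric])

lemma measurable_l1_sphere_sum [measurable]:
  fixes F :: "real \<times> real \<Rightarrow> real"
  assumes "F \<in> borel_measurable borel"
  shows "(\<lambda>(r, s). l1_sphere_sum F r s) \<in> borel_measurable (borel \<Otimes>\<^sub>M borel)"
proof -
  have [measurable]: "F \<in> borel_measurable (borel \<Otimes>\<^sub>M borel)" using assms by (simp add: borel_prod)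
  show ?thesis unfolding l1_sphere_sum_def by measurable
qed

text \<open>For nonnegative \<open>F\<close> and \<open>r\<close> this is four times the mean of
  \<open>F\<close> over the l1-sphere. The factor \<open>r\<close> of the area element is left out,
  so that pointwise bounds on \<open>F\<close> carry over to the profile.\<close>

definition l1_radial :: "(real \<times> real \<Rightarrow> real) \<Rightarrow> real \<Rightarrow> ennreal" where
  "l1_radial F r = (\<integral>\<^sup>+s\<in>{0..1}. ennreal (l1_sphere_sum F r s) \<partial>lborel)"

lemma measurable_l1_radial [measurable]:
  assumes [measurable]: "F \<in> borel_measurable borel"
  shows "l1_radial F \<in> borel_measurable borel"
  unfolding l1_radial_def by measurable

text \<open>The exponent \<open>p + 2\<close> of \<Delta> collects \<open>p\<close> factors from the
  norm, one from the area element and one from rescaling the radius.\<close>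

lemma nn_integral_l1_moment:
  assumes [measurable]: "F \<in> borel_measurable borel" and F: "\<And>x. 0 \<le> F x" and \<Delta>: "0 < \<Delta>"
  shows "(\<integral>\<^sup>+x. ennreal (l1norm x ^ p * F x) \<partial>lborel)
    = ennreal (\<Delta> ^ (p + 2)) * (\<integral>\<^sup>+u\<in>{0..<1}.
        (\<Sum>k. ennreal ((u + real k) ^ (p + 1)) * l1_radial F (\<Delta> * (u + real k))) \<partial>lborel)"
proof -
  let ?f = "\<lambda>x. ennreal (l1norm x ^ p * F x)"
  have sphere: "l1_sphere_sum ?f r s = ennreal (r ^ p) * ennreal (l1_sphere_sum F r s)"
    if "0 \<le> r" "0 \<le> s" "s \<le> 1" for r s
  proof -
    show ?thesis
      using F that l1_sphere_abs[OF that]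
      by (simp add: l1_sphere_sum_def l1norm_def ennreal_mult[symmetric] ennreal_plus[symmetric]
          distrib_left del: ennreal_plus)
  qed
  have "(\<integral>\<^sup>+x. ?f x \<partial>lborel)
    = (\<integral>\<^sup>+r\<in>{0..}. ennreal r * (\<integral>\<^sup>+s\<in>{0..1}. l1_sphere_sum ?f r s \<partial>lborel) \<partial>lborel)"
    by (rule nn_integral_l1_polar) measurable
  also have "\<dots> = (\<integral>\<^sup>+r\<in>{0..}. (ennreal (r ^ (p + 1)) * l1_radial F r) \<partial>lborel)"
  proof (intro nn_integral_cong)
    fix r :: real
    have "ennreal r * (\<integral>\<^sup>+s\<in>{0..1}. l1_sphere_sum ?f r s \<partial>lborel) = ennreal (r ^ (p + 1)) * l1_radial F r"
      if r: "0 \<le> r"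
    proof -
      have "(\<integral>\<^sup>+s\<in>{0..1}. l1_sphere_sum ?f r s \<partial>lborel)
        = (\<integral>\<^sup>+s. ennreal (r ^ p) * (ennreal (l1_sphere_sum F r s) * indicator {0..1} s) \<partial>lborel)"
        using sphere[OF r] by (intro nn_integral_cong) (auto simp: indicator_def)
      also have "\<dots> = ennreal (r ^ p) * l1_radial F r"
        unfolding l1_radial_def by (rule nn_integral_cmult) measurable
      finally show ?thesis using r by (simp add: ennreal_mult mult.assoc)
    qed
    then show "ennreal r * (\<integral>\<^sup>+s\<in>{0..1}. l1_sphere_sum ?f r s \<partial>lborel) * indicator {0..} r
      = ennreal (r ^ (p + 1)) * l1_radial F r * indicator {0..} r"
      by (auto simp: indicator_def)
  qed
  also have "\<dots> = ennreal \<Delta> * (\<integral>\<^sup>+u\<in>{0..<1}.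
      (\<Sum>k. ennreal ((\<Delta> * (u + real k)) ^ (p + 1)) * l1_radial F (\<Delta> * (u + real k))) \<partial>lborel)"
    using \<Delta> by (intro nn_integral_unroll) auto
  also have "\<dots> = ennreal \<Delta> * (\<integral>\<^sup>+u. ennreal (\<Delta> ^ (p + 1)) * ((\<Sum>k. ennreal ((u + real k) ^ (p + 1))
      * l1_radial F (\<Delta> * (u + real k))) * indicator {0..<1} u) \<partial>lborel)"
  proof (intro arg_cong[where f = "(*) (ennreal \<Delta>)"] nn_integral_cong)
    fix u :: real
    have "ennreal ((\<Delta> * (u + real k)) ^ (p + 1)) = ennreal (\<Delta> ^ (p + 1)) * ennreal ((u + real k) ^ (p + 1))"
      if "0 \<le> u" for k
      using that \<Delta> by (subst ennreal_mult[symmetric]) (auto simp: power_mult_distrib simp del: power_Suc)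
    then show "(\<Sum>k. ennreal ((\<Delta> * (u + real k)) ^ (p + 1)) * l1_radial F (\<Delta> * (u + real k))) * indicator {0..<1} u
      = ennreal (\<Delta> ^ (p + 1)) * ((\<Sum>k. ennreal ((u + real k) ^ (p + 1)) * l1_radial F (\<Delta> * (u + real k))) * indicator {0..<1} u)"
      by (auto simp: indicator_def mult.assoc ennreal_suminf_cmult simp del: power_Suc)
  qed
  also have "\<dots> = ennreal \<Delta> * (ennreal (\<Delta> ^ (p + 1)) * (\<integral>\<^sup>+u\<in>{0..<1}. (\<Sum>k. ennreal ((u + real k) ^ (p + 1))
      * l1_radial F (\<Delta> * (u + real k))) \<partial>lborel))"
    by (subst nn_integral_cmult) auto
  finally show ?thesis using \<Delta> by (simp add: ennreal_mult mult.assoc)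
qed

section \<open>Staircase densities\<close>

lemma staircase_fun_step_weight:
  assumes "0 < \<Delta>" "0 \<le> \<gamma>" "\<gamma> \<le> 1" "0 \<le> u" "u < 1" and x: "l1norm x = \<Delta> * (u + real k)"
  shows "staircase_fun \<epsilon> \<Delta> \<gamma> a x = a * step_weight (exp (- \<epsilon>)) \<gamma> u * exp (- \<epsilon>) ^ k"
proof (cases "u < \<gamma>")
  case True
  then have "staircase_fun \<epsilon> \<Delta> \<gamma> a x = exp (- real k * \<epsilon>) * a"
    using assms by (intro staircase_fun_left) (auto simp: algebra_simps)
  then show ?thesis using True by (simp add: step_weight_def exp_of_nat_mult[symmetric])
next
  case False
  then have "staircase_fun \<epsilon> \<Delta> \<gamma> a x = exp (- (real k + 1) * \<epsilon>) * a"
    using assms by (intro staircase_fun_right) (auto simp: algebra_simps)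
  then show ?thesis using False
    by (simp add: step_weight_def exp_of_nat_mult[symmetric] exp_add[symmetric] algebra_simps)
qed

lemma staircase_fun_nonneg: "0 \<le> a \<Longrightarrow> 0 \<le> staircase_fun \<epsilon> \<Delta> \<gamma> a x"
  by (simp add: staircase_fun_def Let_def)

text \<open>A staircase is constant on l1-spheres and exactly geometric along each chain; the factor
  4 counts the edges of the sphere.\<close>

lemma staircase_moment:
  assumes \<epsilon>: "0 < \<epsilon>" and \<Delta>: "0 < \<Delta>" and \<gamma>: "0 \<le> \<gamma>" "\<gamma> \<le> 1" and a: "0 \<le> a"
  shows "(\<integral>\<^sup>+x. ennreal (l1norm x ^ p * staircase_fun \<epsilon> \<Delta> \<gamma> a x) \<partial>lborel)
    = ennreal (\<Delta> ^ (p + 2) * (4 * a)) * (\<integral>\<^sup>+u\<in>{0..<1}.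
        ennreal (step_weight (exp (- \<epsilon>)) \<gamma> u * ladder_sum (p + 1) (exp (- \<epsilon>)) u) \<partial>lborel)"
proof -
  define b where "b = exp (- \<epsilon>)"
  have b: "0 < b" "b < 1" using \<epsilon> by (auto simp: b_def)
  have w: "0 \<le> step_weight b \<gamma> u" for u using b by (simp add: step_weight_def)
  have [measurable]: "ladder_sum p b \<in> borel_measurable borel" for p
    using b by measurable
  have [measurable]: "step_weight b \<gamma> \<in> borel_measurable borel"
    unfolding step_weight_def by measurable
  let ?F = "staircase_fun \<epsilon> \<Delta> \<gamma> a"
  have radial: "l1_radial ?F (\<Delta> * (u + real k)) = ennreal (4 * a * step_weight b \<gamma> u * b ^ k)"
    if u: "0 \<le> u" "u < 1" for u k
  proof -
    have "l1_sphere_sum ?F (\<Delta> * (u + real k)) s = 4 * a * step_weight b \<gamma> u * b ^ k" if "0 \<le> s" "s \<le> 1" for s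
    proof -
      have "\<bar>\<Delta> * (u + real k) * s\<bar> + \<bar>\<Delta> * (u + real k) * (1 - s)\<bar> = \<Delta> * (u + real k)"
        using that u \<Delta> by (intro l1_sphere_abs) auto
      then show ?thesis unfolding l1_sphere_sum_def
        by (subst (1 2 3 4) staircase_fun_step_weight[OF \<Delta> \<gamma> u, of _ k]) (auto simp: l1norm_def b_def)
    qed
    then have "l1_radial ?F (\<Delta> * (u + real k))
      = (\<integral>\<^sup>+s. ennreal (4 * a * step_weight b \<gamma> u * b ^ k) * indicator {0..1::real} s \<partial>lborel)"
      unfolding l1_radial_def by (intro nn_integral_cong) (auto simp: indicator_def)
    then show ?thesis by (simp add: nn_integral_cmult)
  qed
  have "(\<Sum>k. ennreal ((u + real k) ^ (p + 1)) * l1_radial ?F (\<Delta> * (u + real k)))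
     = ennreal (4 * a) * ennreal (step_weight b \<gamma> u * ladder_sum (p + 1) b u)"
    if u: "0 \<le> u" "u < 1" for u
  proof -
    have "(\<Sum>k. ennreal ((u + real k) ^ (p + 1)) * l1_radial ?F (\<Delta> * (u + real k)))
     = (\<Sum>k. ennreal ((u + real k) ^ (p + 1) * (4 * a * step_weight b \<gamma> u * b ^ k)))"
      unfolding radial[OF u] using u a b w by (subst ennreal_mult) auto
    also have "\<dots> = ennreal (4 * a * step_weight b \<gamma> u * ladder_sum (p + 1) b u)"
      using u a b w by (intro suminf_ennreal_ladder) auto
    also have "\<dots> = ennreal (4 * a) * ennreal (step_weight b \<gamma> u * ladder_sum (p + 1) b u)"
      using u a b w by (subst ennreal_mult[symmetric]) (auto simp: ladder_sum_nonneg mult.assoc)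
    finally show ?thesis .
  qed
  then have "(\<integral>\<^sup>+u\<in>{0..<1}. (\<Sum>k. ennreal ((u + real k) ^ (p + 1)) * l1_radial ?F (\<Delta> * (u + real k))) \<partial>lborel)
    = (\<integral>\<^sup>+u. ennreal (4 * a) * (ennreal (step_weight b \<gamma> u * ladder_sum (p + 1) b u) * indicator {0..<1} u) \<partial>lborel)"
    by (intro nn_integral_cong) (auto simp: indicator_def)
  also have "\<dots> = ennreal (4 * a) * (\<integral>\<^sup>+u\<in>{0..<1}. ennreal (step_weight b \<gamma> u * ladder_sum (p + 1) b u) \<partial>lborel)"
    by (rule nn_integral_cmult) measurable
  finally show ?thesis
    using \<Delta> a by (subst nn_integral_l1_moment)
      (auto simp: staircase_fun_nonneg b_def[symmetric] ennreal_mult mult.assoc)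
qed

lemma staircase_const:
  assumes "0 < \<epsilon>" "0 < \<Delta>"
  shows "0 < staircase_const \<epsilon> \<Delta> \<gamma>"
    and "(\<integral>\<^sup>+x. ennreal (staircase_density \<epsilon> \<Delta> \<gamma> x) \<partial>lborel) = 1"
  using theI'[OF ex1_staircase_const[OF assms, of \<gamma>]]
  unfolding staircase_const_def[symmetric] staircase_density_def by auto

text \<open>The function drops by the factor \<open>exp (- \<epsilon>)\<close> at the radii
  \<open>(k + \<gamma>) * \<Delta>\<close>, and a half-open interval of length \<Delta> contains at
  most one of them.\<close>

lemma staircase_fun_ratio:
  assumes \<epsilon>: "0 < \<epsilon>" and \<Delta>: "0 < \<Delta>" and \<gamma>: "0 \<le> \<gamma>" "\<gamma> \<le> 1" and a: "0 < a"
    and xy: "l1norm y \<le> l1norm x + \<Delta>"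
  shows "staircase_fun \<epsilon> \<Delta> \<gamma> a x \<le> exp \<epsilon> * staircase_fun \<epsilon> \<Delta> \<gamma> a y"
proof -
  \<comment> \<open>\<open>j z\<close> counts the drops up to the radius
    \<open>l1norm z\<close>.\<close>
  define j where "j z = (let k = nat \<lfloor>l1norm z / \<Delta>\<rfloor> in
     if l1norm z < (real k + \<gamma>) * \<Delta> then real k else real k + 1)" for z
  have j: "staircase_fun \<epsilon> \<Delta> \<gamma> a z = exp (- j z * \<epsilon>) * a" for z
    by (simp add: staircase_fun_def j_def Let_def algebra_simps)
  have "j y \<le> j x + 1"
  proof -
    define k where "k z = nat \<lfloor>l1norm z / \<Delta>\<rfloor>" for z
    have k: "real (k z) \<le> l1norm z / \<Delta>" "l1norm z / \<Delta> < real (k z) + 1" for z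
    proof -
      have "0 \<le> l1norm z / \<Delta>" using l1norm_nonneg[of z] \<Delta> by simp
      then show "real (k z) \<le> l1norm z / \<Delta>" "l1norm z / \<Delta> < real (k z) + 1"
        unfolding k_def by linarith+
    qed
    have le: "l1norm y / \<Delta> \<le> l1norm x / \<Delta> + 1" using xy \<Delta> by (simp add: field_simps)
    have ky: "k y \<le> k x + 1" using k(1)[of y] k(2)[of x] le by linarith
    have lt: "l1norm z < (real (k z) + \<gamma>) * \<Delta> \<longleftrightarrow> l1norm z / \<Delta> < real (k z) + \<gamma>" for z
      using \<Delta> by (simp add: field_simps)
    show ?thesis
    \<comment> \<open>If \<open>y\<close> lies one period further out, its position within the
      period is not ahead of that of \<open>x\<close>, and both are compared with the same
      \<gamma>.\<close>
    proof (cases "k y = k x + 1")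
      case True
      then have "real (k y) = real (k x) + 1" by simp
      then show ?thesis using le unfolding j_def Let_def k_def[symmetric] lt by auto
    next
      case False
      then have "real (k y) \<le> real (k x)" using ky by simp
      then show ?thesis unfolding j_def Let_def k_def[symmetric] by auto
    qed
  qed
  then have "(j y - 1) * \<epsilon> \<le> j x * \<epsilon>" using \<epsilon> by (intro mult_right_mono) auto
  then have "exp (- j x * \<epsilon>) \<le> exp \<epsilon> * exp (- j y * \<epsilon>)"
    by (simp add: exp_add[symmetric] algebra_simps)
  then show ?thesis using a unfolding j by (simp add: mult.assoc[symmetric])
qed

section \<open>Differentially private measures\<close>

text \<open>Points with equal \<open>s\<close> and equal signs on spheres whose radii differ by at
  most \<Delta> are at l1-distance at most \<Delta>. The ratio bound therefore passes to the sphere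
  averages, and \<open>ladder_minimum\<close> applies with \<open>V / \<Delta>\<close> for
  \<open>V\<close>.\<close>

lemma private_density_cost_ge:
  fixes F :: "real \<times> real \<Rightarrow> real"
  assumes \<epsilon>: "0 < \<epsilon>" and \<Delta>: "0 < \<Delta>" and V: "0 \<le> V"
    and F [measurable]: "F \<in> borel_measurable borel" and F0: "\<And>x. 0 \<le> F x" and FK: "\<And>x. F x \<le> K"
    and ratio: "\<And>x y. l1norm (y - x) \<le> \<Delta> \<Longrightarrow> F x \<le> exp \<epsilon> * F y"
    and stair: "\<And>\<gamma>. \<gamma> \<in> {0..1} \<Longrightarrow>
      ennreal V \<le> (\<integral>\<^sup>+x. ennreal (l1norm x * staircase_density \<epsilon> \<Delta> \<gamma> x) \<partial>lborel)"
  shows "ennreal V * (\<integral>\<^sup>+x. ennreal (F x) \<partial>lborel) \<le> (\<integral>\<^sup>+x. ennreal (l1norm x * F x) \<partial>lborel)"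
proof -
  define b where "b = exp (- \<epsilon>)"
  have b: "0 < b" "b < 1" using \<epsilon> by (auto simp: b_def)
  have priv: "b * F x \<le> F y" if "l1norm (y - x) \<le> \<Delta>" for x y
    using ratio[OF that] by (simp add: b_def exp_minus field_simps)
  define g where "g r = enn2real (l1_radial F (\<Delta> * r))" for r
  have [measurable]: "g \<in> borel_measurable borel" unfolding g_def by measurable
  have g0: "0 \<le> g r" for r by (simp add: g_def)
  have le: "l1_radial F r \<le> ennreal (4 * K)" for r
  proof -
    have "l1_radial F r \<le> (\<integral>\<^sup>+s. ennreal (4 * K) * indicator {0..1::real} s \<partial>lborel)"
      unfolding l1_radial_def
    proof (intro nn_integral_mono mult_right_mono ennreal_leI)
      fix s show "l1_sphere_sum F r s \<le> 4 * K"
        unfolding l1_sphere_sum_def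
        using FK[of "(r * s, r * (1 - s))"] FK[of "(r * s, - (r * (1 - s)))"]
          FK[of "(- (r * s), r * (1 - s))"] FK[of "(- (r * s), - (r * (1 - s)))"] by linarith
    qed simp
    then show ?thesis by (simp add: nn_integral_cmult)
  qed
  then have g: "l1_radial F (\<Delta> * r) = ennreal (g r)" for r
    unfolding g_def by (simp add: le_less_trans[OF le])
  have K: "0 \<le> K" using F0[of 0] FK[of 0] by linarith
  have gK: "g r \<le> 4 * K" for r
    using le[of "\<Delta> * r"] K unfolding g by (simp add: ennreal_le_iff)
  have sphere0: "0 \<le> l1_sphere_sum F r s" for r s using F0 by (simp add: l1_sphere_sum_def)
  have "slow_decay b g"
    unfolding slow_decay_def
  proof (intro allI impI)
    fix r r' :: real assume r: "0 \<le> r" "0 \<le> r'" "\<bar>r - r'\<bar> \<le> 1"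
    have "b * l1_sphere_sum F (\<Delta> * r) s \<le> l1_sphere_sum F (\<Delta> * r') s" if s: "0 \<le> s" "s \<le> 1" for s
    proof -
      define d where "d = \<Delta> * r' - \<Delta> * r"
      have "\<bar>d * s\<bar> + \<bar>d * (1 - s)\<bar> = \<bar>d\<bar> * (\<bar>s\<bar> + \<bar>1 - s\<bar>)"
        by (simp add: abs_mult distrib_left)
      also have "\<dots> = \<bar>d\<bar>" using s by simp
      also have "\<bar>d\<bar> = \<Delta> * \<bar>r - r'\<bar>"
        unfolding d_def using \<Delta> by (simp add: right_diff_distrib[symmetric] abs_mult abs_minus_commute)
      also have "\<dots> \<le> \<Delta> * 1" using r \<Delta> by (intro mult_left_mono) auto
      finally have dist: "\<bar>\<Delta> * r' * s - \<Delta> * r * s\<bar> + \<bar>\<Delta> * r' * (1 - s) - \<Delta> * r * (1 - s)\<bar> \<le> \<Delta>"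
        by (simp add: d_def left_diff_distrib)
      have p: "b * F (x, y) \<le> F (x', y')" if "\<bar>x' - x\<bar> + \<bar>y' - y\<bar> \<le> \<Delta>" for x x' y y'
        using that by (intro priv) (simp add: l1norm_def)
      show ?thesis
        unfolding l1_sphere_sum_def distrib_left
        by (intro add_mono p; use dist in linarith)
    qed
    then have "(\<integral>\<^sup>+s. ennreal b * (ennreal (l1_sphere_sum F (\<Delta> * r) s) * indicator {0..1} s) \<partial>lborel)
      \<le> l1_radial F (\<Delta> * r')"
      unfolding l1_radial_def using b sphere0
      by (intro nn_integral_mono)
        (auto simp: indicator_def ennreal_mult[symmetric] intro!: ennreal_leI)
    then have "ennreal b * l1_radial F (\<Delta> * r) \<le> l1_radial F (\<Delta> * r')"
      unfolding l1_radial_def by (subst (asm) nn_integral_cmult) auto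
    then show "b * g r \<le> g r'"
      using b g0 unfolding g by (simp add: ennreal_mult[symmetric])
  qed
  moreover have "ennreal (V / \<Delta>) * (\<integral>\<^sup>+u\<in>{0..<1}. ennreal (step_weight b \<gamma> u * ladder_sum 1 b u) \<partial>lborel)
        \<le> (\<integral>\<^sup>+u\<in>{0..<1}. ennreal (step_weight b \<gamma> u * ladder_sum 2 b u) \<partial>lborel)" (is "_ * ?t \<le> ?s")
    if \<gamma>: "0 \<le> \<gamma>" "\<gamma> \<le> 1" for \<gamma>
  proof -
    \<comment> \<open>Normalization makes \<open>\<Delta> ^ 2 * (4 * a) * ?t\<close> equal to 1,
      which turns the cost bound into a homogeneous inequality free of \<open>a\<close>.\<close>
    define a where "a = staircase_const \<epsilon> \<Delta> \<gamma>"
    have a: "0 < a" "(\<integral>\<^sup>+x. ennreal (staircase_fun \<epsilon> \<Delta> \<gamma> a x) \<partial>lborel) = 1"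
      using staircase_const[OF \<epsilon> \<Delta>, of \<gamma>] by (auto simp: a_def staircase_density_def)
    have mass: "1 = ennreal (\<Delta>\<^sup>2 * (4 * a)) * ?t"
      using staircase_moment[OF \<epsilon> \<Delta> \<gamma>, of a 0] a by (simp add: b_def numeral_2_eq_2)
    have cost: "ennreal V \<le> ennreal (\<Delta> ^ 3 * (4 * a)) * ?s"
      using stair[of \<gamma>] staircase_moment[OF \<epsilon> \<Delta> \<gamma>, of a 1] a \<gamma>
      by (simp add: b_def staircase_density_def a_def[symmetric] numeral_3_eq_3 numeral_2_eq_2)
    have "ennreal (\<Delta> ^ 3 * (4 * a)) * (ennreal (V / \<Delta>) * ?t) = ennreal V * (ennreal (\<Delta>\<^sup>2 * (4 * a)) * ?t)"
      unfolding mult.assoc[symmetric] using V \<Delta> a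
      by (simp add: ennreal_mult[symmetric] power2_eq_square power3_eq_cube field_simps)
    also have "\<dots> \<le> ennreal (\<Delta> ^ 3 * (4 * a)) * ?s"
      using cost unfolding mass[symmetric] by simp
    finally show ?thesis
      using \<Delta> a by (subst (asm) ennreal_mult_le_mult_iff) (auto simp: ennreal_eq_0_iff not_le)
  qed
  ultimately have key: "ennreal (V / \<Delta>) * (\<integral>\<^sup>+u\<in>{0..<1}. (\<Sum>k. ennreal ((u + real k) * g (u + real k))) \<partial>lborel)
    \<le> (\<integral>\<^sup>+u\<in>{0..<1}. (\<Sum>k. ennreal ((u + real k)\<^sup>2 * g (u + real k))) \<partial>lborel)" (is "_ * ?B \<le> ?A")
    using V \<Delta> g0 gK by (intro ladder_minimum[OF b]) auto
  have moment: "(\<integral>\<^sup>+u\<in>{0..<1}. (\<Sum>k. ennreal ((u + real k) ^ (p + 1)) * l1_radial F (\<Delta> * (u + real k))) \<partial>lborel)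
    = (\<integral>\<^sup>+u\<in>{0..<1}. (\<Sum>k. ennreal ((u + real k) ^ (p + 1) * g (u + real k))) \<partial>lborel)" for p
    unfolding g using g0 by (intro nn_integral_cong) (auto simp: indicator_def ennreal_mult simp del: power_Suc)
  have mass: "(\<integral>\<^sup>+x. ennreal (F x) \<partial>lborel) = ennreal (\<Delta>\<^sup>2) * ?B"
    using nn_integral_l1_moment[OF F F0 \<Delta>, of 0] unfolding moment by (simp add: power2_eq_square)
  have cost: "(\<integral>\<^sup>+x. ennreal (l1norm x * F x) \<partial>lborel) = ennreal (\<Delta> ^ 3) * ?A"
    using nn_integral_l1_moment[OF F F0 \<Delta>, of 1] unfolding moment by (simp add: numeral_3_eq_3 numeral_2_eq_2)
  have "ennreal V * (ennreal (\<Delta>\<^sup>2) * ?B) = ennreal (\<Delta> ^ 3) * (ennreal (V / \<Delta>) * ?B)"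
    unfolding mult.assoc[symmetric] using V \<Delta>
    by (simp add: ennreal_mult[symmetric] power2_eq_square power3_eq_cube field_simps)
  also have "\<dots> \<le> ennreal (\<Delta> ^ 3) * ?A" by (intro mult_left_mono key) auto
  finally show ?thesis unfolding mass cost .
qed

section \<open>Privacy of the staircase measures\<close>

lemma image_translate_borel:
  fixes S :: "'a :: real_normed_vector set"
  assumes "S \<in> sets borel"
  shows "(\<lambda>s. s + t) ` S \<in> sets borel"
proof -
  have "(\<lambda>s. s + t) ` S = (\<lambda>x. x - t) -` S \<inter> space borel"
    by (auto simp: image_iff intro!: bexI[of _ "_ - t"])
  also have "\<dots> \<in> sets borel"
    by (intro measurable_sets[OF _ assms] borel_measurable_continuous_onI continuous_intros)
  finally show ?thesis .
qed

text \<open>The pointwise bound \<open>staircase_fun_ratio\<close> is integrated over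
  \<open>S\<close>, and the variable is shifted by \<open>t\<close>, which preserves Lebesgue
  measure.\<close>

lemma staircase_density_in_SP:
  assumes \<epsilon>: "0 < \<epsilon>" and \<Delta>: "0 < \<Delta>" and \<gamma>: "\<gamma> \<in> {0..1}"
  shows "density lborel (\<lambda>x. ennreal (staircase_density \<epsilon> \<Delta> \<gamma> x)) \<in> SP \<epsilon> \<Delta>"
proof -
  let ?d = "staircase_density \<epsilon> \<Delta> \<gamma>"
  let ?P = "density lborel (\<lambda>x. ennreal (?d x))"
  have [measurable]: "?d \<in> borel_measurable borel" unfolding staircase_density_def by measurable
  have prob: "prob_space ?P"
    using staircase_const(2)[OF \<epsilon> \<Delta>, of \<gamma>] by (intro prob_spaceI) (simp add: emeasure_density)
  interpret prob_space ?P by fact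
  have "measure ?P S \<le> exp \<epsilon> * measure ?P ((\<lambda>s. s + t) ` S)"
    if [measurable]: "S \<in> sets borel" and t: "l1norm t \<le> \<Delta>" for S t
  proof -
    note [measurable] = image_translate_borel[OF that(1), of t]
    have "emeasure ?P S = (\<integral>\<^sup>+x\<in>S. ennreal (?d x) \<partial>lborel)"
      by (simp add: emeasure_density)
    also have "\<dots> \<le> (\<integral>\<^sup>+x. ennreal (exp \<epsilon>) * (ennreal (?d (t + x)) * indicator ((\<lambda>s. s + t) ` S) (t + x)) \<partial>lborel)"
    proof (intro nn_integral_mono)
      fix x
      have "l1norm (t + x) \<le> l1norm x + \<Delta>" using l1norm_triangle[of t x] t by linarith
      then have "?d x \<le> exp \<epsilon> * ?d (t + x)"
        using staircase_fun_ratio[OF \<epsilon> \<Delta>] \<gamma> staircase_const(1)[OF \<epsilon> \<Delta>, of \<gamma>]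
        unfolding staircase_density_def by auto
      then show "ennreal (?d x) * indicator S x
        \<le> ennreal (exp \<epsilon>) * (ennreal (?d (t + x)) * indicator ((\<lambda>s. s + t) ` S) (t + x))"
        by (auto simp: indicator_def ennreal_mult'[symmetric] image_iff add.commute intro!: ennreal_leI)
    qed
    also have "\<dots> = ennreal (exp \<epsilon>) * (\<integral>\<^sup>+x. ennreal (?d (t + x)) * indicator ((\<lambda>s. s + t) ` S) (t + x) \<partial>lborel)"
      by (rule nn_integral_cmult) measurable
    also have "(\<integral>\<^sup>+x. ennreal (?d (t + x)) * indicator ((\<lambda>s. s + t) ` S) (t + x) \<partial>lborel)
      = (\<integral>\<^sup>+x. ennreal (?d x) * indicator ((\<lambda>s. s + t) ` S) x \<partial>distr lborel borel ((+) t))"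
      by (subst nn_integral_distr) auto
    also have "\<dots> = emeasure ?P ((\<lambda>s. s + t) ` S)"
      by (simp add: lborel_distr_plus emeasure_density)
    finally show ?thesis by (simp add: emeasure_eq_measure ennreal_mult[symmetric])
  qed
  then show ?thesis using prob by (simp add: SP_def)
qed

section \<open>Mollification of private measures\<close>

lemma SP_ratio:
  assumes "P \<in> SP \<epsilon> \<Delta>" "S \<in> sets borel" "l1norm t \<le> \<Delta>"
  shows "measure P S \<le> exp \<epsilon> * measure P ((\<lambda>s. s + t) ` S)"
  using assms unfolding SP_def by blast

lemma emeasure_lborel_square:
  "0 \<le> \<eta> \<Longrightarrow> emeasure lborel ({a..a + \<eta>} \<times> {c..c + \<eta> :: real}) = ennreal (\<eta>\<^sup>2)" for a c \<eta> :: real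
  by (subst lborel_prod[symmetric], subst lborel.emeasure_pair_measure_Times)
    (auto simp: ennreal_mult[symmetric] power2_eq_square)

text \<open>A measure in \<^const>\<open>SP\<close> is replaced by its mollification over small squares, whose density
  satisfies the privacy inequality at every point and not only almost everywhere.\<close>

lemma SP_cost_ge:
  assumes \<epsilon>: "0 < \<epsilon>" and \<Delta>: "0 < \<Delta>" and V: "0 \<le> V" and P: "P \<in> SP \<epsilon> \<Delta>"
    and stair: "\<And>\<gamma>. \<gamma> \<in> {0..1} \<Longrightarrow>
      ennreal V \<le> (\<integral>\<^sup>+x. ennreal (l1norm x * staircase_density \<epsilon> \<Delta> \<gamma> x) \<partial>lborel)"
  shows "ennreal V \<le> (\<integral>\<^sup>+x. ennreal (l1norm x) \<partial>P)"
proof (rule ennreal_le_epsilon)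
  fix e :: real assume e: "0 < e"
  \<comment> \<open>Two points of a square of side \<eta> are at l1-distance at most
    \<open>2 * \<eta>\<close>, which is the whole error in the cost.\<close>
  define \<eta> where "\<eta> = e / 2"
  have \<eta>: "0 < \<eta>" "2 * \<eta> = e" using e by (auto simp: \<eta>_def)
  interpret prob_space P using P by (simp add: SP_def)
  have sets_P [measurable_cong]: "sets P = sets borel" using P by (simp add: SP_def)
  interpret pair_sigma_finite P "lborel :: (real \<times> real) measure" ..
  define Q where "Q x = {fst x..fst x + \<eta>} \<times> {snd x..snd x + \<eta>}" for x :: "real \<times> real"
  \<comment> \<open>Divided by \<open>\<eta> ^ 2\<close> this is the density of the convolution of
    \<open>P\<close> with the uniform law on \<open>{- \<eta>..0} \<times> {- \<eta>..0}\<close>. It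
    is left unnormalized, as the inequality applied to it is homogeneous.\<close>
  define F where "F x = measure P (Q x)" for x
  have Q_closed: "closed (Q x)" for x unfolding Q_def by (intro closed_Times) auto
  have Q_sets [measurable]: "Q x \<in> sets borel" for x using Q_closed by (rule borel_closed)
  \<comment> \<open>Membership as one closed relation provides the joint measurability on which
    measurability of \<open>F\<close> and the exchange of integrals rest.\<close>
  define W where "W = {z :: (real \<times> real) \<times> (real \<times> real). snd z \<in> Q (fst z)}"
  have "closed W"
    unfolding W_def Q_def mem_Times_iff atLeastAtMost_iff
    by (intro closed_Collect_conj closed_Collect_le continuous_intros)
  then have "W \<in> sets borel" by (rule borel_closed)
  then have W [measurable]: "W \<in> sets (borel \<Otimes>\<^sub>M borel)" by (subst borel_prod)
  have ind: "indicator (Q x) y = (indicator W (x, y) :: ennreal)" for x y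
    by (simp add: indicator_def W_def)
  have F_eq: "ennreal (F x) = (\<integral>\<^sup>+y. indicator W (x, y) \<partial>P)" for x
  proof -
    have "(\<integral>\<^sup>+y. indicator W (x, y) \<partial>P) = (\<integral>\<^sup>+y. indicator (Q x) y \<partial>P)" by (simp add: ind)
    then show ?thesis unfolding F_def by (simp add: emeasure_eq_measure sets_P)
  qed
  have "F = (\<lambda>x. enn2real (\<integral>\<^sup>+y. indicator W (x, y) \<partial>P))"
    unfolding F_eq[symmetric] by (simp add: F_def fun_eq_iff)
  then have F_meas [measurable]: "F \<in> borel_measurable borel" by simp
  have swap: "(\<integral>\<^sup>+x. ennreal (h x * F x) \<partial>lborel)
      = (\<integral>\<^sup>+y. (\<integral>\<^sup>+x. ennreal (h x) * indicator W (x, y) \<partial>lborel) \<partial>P)"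
    if [measurable]: "h \<in> borel_measurable borel" and h: "\<And>x. 0 \<le> h x" for h
  proof -
    have "(\<integral>\<^sup>+x. ennreal (h x * F x) \<partial>lborel)
        = (\<integral>\<^sup>+x. (\<integral>\<^sup>+y. ennreal (h x) * indicator W (x, y) \<partial>P) \<partial>lborel)"
      using h by (simp add: nn_integral_cmult ennreal_mult' F_eq)
    also have "\<dots> = (\<integral>\<^sup>+y. (\<integral>\<^sup>+x. ennreal (h x) * indicator W (x, y) \<partial>lborel) \<partial>P)"
      by (rule Fubini') measurable
    finally show ?thesis .
  qed
  have square: "(\<integral>\<^sup>+x. indicator W (x, y) \<partial>lborel) = ennreal (\<eta>\<^sup>2)" for y
  proof -
    \<comment> \<open>The corners \<open>x\<close> whose square contains \<open>y\<close> form the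
      square with upper right corner \<open>y\<close>.\<close>
    let ?S = "{fst y - \<eta>..fst y - \<eta> + \<eta>} \<times> {snd y - \<eta>..snd y - \<eta> + \<eta>}"
    have "(\<integral>\<^sup>+x. indicator W (x, y) \<partial>lborel) = (\<integral>\<^sup>+x. indicator ?S x \<partial>lborel)"
      by (intro nn_integral_cong) (auto simp: W_def Q_def mem_Times_iff split: split_indicator)
    also have "\<dots> = emeasure lborel ?S"
      by (intro nn_integral_indicator) (auto intro!: borel_closed closed_Times)
    also have "\<dots> = ennreal (\<eta>\<^sup>2)" using \<eta> by (intro emeasure_lborel_square) auto
    finally show ?thesis .
  qed
  have mass: "(\<integral>\<^sup>+x. ennreal (F x) \<partial>lborel) = ennreal (\<eta>\<^sup>2)"
    using swap[of "\<lambda>_. 1"] by (simp add: square emeasure_space_1)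
  have "(\<integral>\<^sup>+x. ennreal (l1norm x * F x) \<partial>lborel)
      = (\<integral>\<^sup>+y. (\<integral>\<^sup>+x. ennreal (l1norm x) * indicator W (x, y) \<partial>lborel) \<partial>P)"
    by (intro swap) (auto simp: l1norm_nonneg)
  also have "\<dots> \<le> (\<integral>\<^sup>+y. (\<integral>\<^sup>+x. ennreal (l1norm y + e) * indicator W (x, y) \<partial>lborel) \<partial>P)"
  proof (intro nn_integral_mono)
    fix x y
    have "l1norm x \<le> l1norm y + e" if "(x, y) \<in> W"
      using that \<eta> by (auto simp: W_def Q_def mem_Times_iff l1norm_def)
    then show "ennreal (l1norm x) * indicator W (x, y) \<le> ennreal (l1norm y + e) * indicator W (x, y)"
      by (auto simp: indicator_def intro!: ennreal_leI)
  qed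
  also have "\<dots> = (\<integral>\<^sup>+y. (ennreal (l1norm y) + ennreal e) * ennreal (\<eta>\<^sup>2) \<partial>P)"
    using e by (simp add: nn_integral_cmult square l1norm_nonneg)
  also have "\<dots> = ennreal (\<eta>\<^sup>2) * ((\<integral>\<^sup>+y. ennreal (l1norm y) \<partial>P) + ennreal e)"
    by (subst nn_integral_multc) (simp_all add: nn_integral_add emeasure_space_1 mult.commute)
  finally have cost: "(\<integral>\<^sup>+x. ennreal (l1norm x * F x) \<partial>lborel)
      \<le> ennreal (\<eta>\<^sup>2) * ((\<integral>\<^sup>+y. ennreal (l1norm y) \<partial>P) + ennreal e)" .
  have "ennreal V * (\<integral>\<^sup>+x. ennreal (F x) \<partial>lborel) \<le> (\<integral>\<^sup>+x. ennreal (l1norm x * F x) \<partial>lborel)"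
  proof (rule private_density_cost_ge[OF \<epsilon> \<Delta> V F_meas _ _ _ stair])
    \<comment> \<open>Translation by \<open>y - x\<close> carries \<open>Q x\<close> onto
      \<open>Q y\<close>, so the privacy of \<open>P\<close> on this one set gives the pointwise
      ratio.\<close>
    fix x y assume "l1norm (y - x) \<le> \<Delta>"
    then have "F x \<le> exp \<epsilon> * measure P ((\<lambda>s. s + (y - x)) ` Q x)"
      unfolding F_def using SP_ratio[OF P Q_sets] by simp
    also have "(\<lambda>s. s + (y - x)) ` Q x = Q y"
    proof (intro set_eqI iffI)
      fix z assume "z \<in> Q y"
      then have "z - (y - x) \<in> Q x" by (auto simp: Q_def mem_Times_iff)
      then show "z \<in> (\<lambda>s. s + (y - x)) ` Q x" by (intro image_eqI[of _ _ "z - (y - x)"]) auto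
    qed (auto simp: Q_def mem_Times_iff)
    finally show "F x \<le> exp \<epsilon> * F y" by (simp add: F_def)
  next
    show "F x \<le> 1" for x by (simp add: F_def)
  qed (simp_all add: F_def)
  then have "ennreal (\<eta>\<^sup>2) * ennreal V \<le> ennreal (\<eta>\<^sup>2) * ((\<integral>\<^sup>+y. ennreal (l1norm y) \<partial>P) + ennreal e)"
    unfolding mass using cost by (simp add: mult.commute)
  then show "ennreal V \<le> (\<integral>\<^sup>+x. ennreal (l1norm x) \<partial>P) + ennreal e"
    using \<eta> by (subst (asm) ennreal_mult_le_mult_iff) auto
qed

theorem theorem1:
  fixes \<epsilon> \<Delta> :: real
  assumes "\<epsilon> > 0" and "\<Delta> > 0"
  shows "(INF P \<in> SP \<epsilon> \<Delta>. \<integral>\<^sup>+ x. ennreal (l1norm x) \<partial>P) =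
         (INF \<gamma> \<in> {0..1}. \<integral>\<^sup>+ x. ennreal (l1norm x * staircase_density \<epsilon> \<Delta> \<gamma> x) \<partial>lborel)"
    (is "?L = ?R")
proof (rule antisym)
  show "?L \<le> ?R"
  proof (rule INF_mono)
    fix \<gamma> :: real assume \<gamma>: "\<gamma> \<in> {0..1}"
    have [measurable]: "staircase_density \<epsilon> \<Delta> \<gamma> \<in> borel_measurable borel"
      unfolding staircase_density_def by measurable
    have "(\<integral>\<^sup>+x. ennreal (l1norm x) \<partial>density lborel (\<lambda>x. ennreal (staircase_density \<epsilon> \<Delta> \<gamma> x)))
      = (\<integral>\<^sup>+x. ennreal (l1norm x * staircase_density \<epsilon> \<Delta> \<gamma> x) \<partial>lborel)"
      by (subst nn_integral_density)
        (auto simp: ennreal_mult' l1norm_nonneg mult.commute intro!: nn_integral_cong)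
    then show "\<exists>P\<in>SP \<epsilon> \<Delta>. (\<integral>\<^sup>+x. ennreal (l1norm x) \<partial>P)
      \<le> (\<integral>\<^sup>+x. ennreal (l1norm x * staircase_density \<epsilon> \<Delta> \<gamma> x) \<partial>lborel)"
      using staircase_density_in_SP[OF assms \<gamma>] by (intro bexI) auto
  qed
  show "?R \<le> ?L"
  proof (rule INF_greatest, rule ccontr)
    fix P assume P: "P \<in> SP \<epsilon> \<Delta>" and "\<not> ?R \<le> (\<integral>\<^sup>+x. ennreal (l1norm x) \<partial>P)"
    \<comment> \<open>\<open>SP_cost_ge\<close> takes a real bound, while \<open>?R\<close> is an
      \<open>ennreal\<close>; a value strictly below \<open>?R\<close> is finite.\<close>
    then obtain v where v: "(\<integral>\<^sup>+x. ennreal (l1norm x) \<partial>P) < v" "v < ?R"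
      using dense[of "\<integral>\<^sup>+x. ennreal (l1norm x) \<partial>P" ?R] by (auto simp: not_le)
    then obtain V where V: "v = ennreal V" "0 \<le> V" by (cases v) auto
    have "ennreal V \<le> (\<integral>\<^sup>+x. ennreal (l1norm x * staircase_density \<epsilon> \<Delta> \<gamma> x) \<partial>lborel)"
      if "\<gamma> \<in> {0..1}" for \<gamma>
      using less_le_trans[OF v(2) INF_lower[OF that]] unfolding V(1) by (rule less_imp_le)
    then have "ennreal V \<le> (\<integral>\<^sup>+x. ennreal (l1norm x) \<partial>P)"
      by (intro SP_cost_ge[OF assms V(2) P])
    then show False using v(1) V(1) by simp
  qed
qed

end
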